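(* Let $M$ be a monoid with monoid presentation $\langle X_M : R_M\rangle$ via a surjective morphism $\phi_M:X_M^*\to M$, and write $\overline x=x\phi_M$ for $x\in X_M$. Let $n\ge2$ and $\mathbf n=\{1,\ldots,n\}$. Let $X$ be the alphabet $$X=\{f_{i,j}:i,j\in\mathbf n,\ i\ne j\}\cup\{e_1,\ldots,e_n\}\cup\{x^{(i;j)}:x\in X_M,\ i,j\in\mathbf n,\ i\ne j\}$$ (all listed letters being distinct). For a word $w=x_1\cdots x_k\in X_M^*$ and distinct $i,j\in\mathbf n$, let $w^{(i;j)}=x_1^{(i;j)}\cdots x_k^{(i;j)}$ if $k\ge1$, and $w^{(i;j)}=e_j$ if $k=0$. Let $R$ be the set consisting of the following three groups of relations over $X$. (A) For all distinct $i,j,k,l\in\mathbf n$ (only the indices occurring in a given relation being required to exist and be distinct): - $f_{i,j}f_{j,i}f_{i,j}=f_{i,j}$; - $f_{i,j}^3=f_{i,j}^2=f_{j,i}^2$; - $f_{i,j}f_{k,l}=f_{k,l}f_{i,j}$; - $f_{i,j}f_{j,i}=f_{i,k}f_{k,i}$; - $f_{i,j}f_{i,k}=f_{j,k}f_{i,j}=f_{i,k}f_{j,k}$; - $f_{k,i}f_{i,j}f_{j,k}=f_{k,j}f_{j,i}f_{i,k}$; - $f_{k,i}f_{i,j}f_{j,k}f_{k,l}=f_{k,l}f_{l,i}f_{i,j}f_{j,l}$. (B) For all $x,y\in X_M$ and all $i,j,k\in\mathbf n$ for which the letters are defined, subject to stated constraints: - $e_i^2=e_i$; - $e_ie_j=e_je_i$;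 - $u^{(i;j)}=v^{(i;j)}$ for $(u,v)\in R_M$; - $x^{(i;j)}e_k=e_kx^{(i;j)}=e_jx^{(i;k)}$ if $k\ne i,j$; - $x^{(i;j)}e_j=e_jx^{(i;j)}=x^{(i;j)}$; - $x^{(i;j)}e_i=e_ix^{(i;j)}=e_ie_j$; - $x^{(i;k)}y^{(j;k)}=y^{(j;k)}x^{(i;k)}$ if $i\ne j$. (C) For all $x\in X_M$ and all $i,j,k,l\in\mathbf n$ (not assumed distinct) for which all the letters in the relation are defined, subject to stated constraints: - $f_{i,j}f_{j,i}=e_i$; - $f_{i,j}x^{(i;j)}=x^{(j;i)}f_{i,j}$; - $f_{i,j}x^{(i;k)}=x^{(j;k)}f_{i,j}$; - $f_{i,j}x^{(k;i)}=x^{(k;i)}e_j$; - $f_{i,j}x^{(j;k)}=f_{i,j}f_{k,j}$; - $f_{i,j}x^{(k;j)}=x^{(k;i)}f_{i,j}$; - $f_{i,j}x^{(k;l)}=x^{(k;l)}f_{i,j}$ if $\{i,j\}\cap\{k,l\}=\varnothing$. Let $\phi:X^+\to M\wr\mathrm{Sing}(\mathcal I_n)$ be the semigroup morphism determined by - $f_{i,j}\mapsto(\mathbf a,\overline f_{i,j})$, where $\mathbf a$ has $0$ in position $i$ and $1$ elsewhere, and $\overline f_{i,j}$ is the partial map with domain $\mathbf n\setminus\{i\}$ given by $j\mapsto i$ and $k\mapsto k$ for $k\ne i,j$; - $e_i\mapsto(\mathbf a,\mathrm{id}_{\mathbf n\setminus\{i\}})$, where $\mathbf a$ has $0$ in position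 $i$ and $1$ elsewhere; - $x^{(i;j)}\mapsto(\mathbf a,\mathrm{id}_{\mathbf n\setminus\{j\}})$, where $\mathbf a$ has $\overline x$ in position $i$, $0$ in position $j$ and $1$ elsewhere. Then the singular wreath product $M\wr\mathrm{Sing}(\mathcal I_n)$ has semigroup presentation $\langle X:R\rangle$ via $\phi$.
   Context: The symmetric inverse monoid $\mathcal I_n$ is the monoid of all injective partial maps $\mathbf n\to\mathbf n$ under composition of partial maps, composed left to right ($i(\alpha\beta)=(i\alpha)\beta$). $\mathcal S_n$ is the symmetric group (the group of units of $\mathcal I_n$), and $\mathrm{Sing}(\mathcal I_n)=\mathcal I_n\setminus\mathcal S_n$, a subsemigroup of $\mathcal I_n$. For $A\subseteq\mathbf n$, $\mathrm{id}_A$ is the identity map on $A$. $M_0=M\cup\{0\}$ is obtained from $M$ (with identity $1$) by adjoining a new symbol $0$ as a zero element (even if $M$ already has a zero). $M_0^n$ is the direct power (componentwise product). For $\mathbf a=(a_1,\ldots,a_n)\in M_0^n$, $\mathrm{supp}(\mathbf a)=\{i\in\mathbf n:a_i\ne0\}$. For $\alpha\in\mathcal I_n$ and $\mathbf a\in M_0^n$, ${}^\alpha\mathbf a=(b_1,\ldots,b_n)$ where $b_i=a_{i\alpha}$ if $i\in\mathrm{dom}(\alpha)$ and $b_i=0$ otherwise. The singular wreath product is the semigroup $$M\wr\mathrm{Sing}(\mathcal I_n)=\{(\mathbf a,\alpha)\in M_0^n\times\mathrm{Sing}(\mathcal I_n):\mathrm{supp}(\mathbf a)=\mathrm{dom}(\alpha)\},\qquad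 (\mathbf a,\alpha)(\mathbf b,\beta)=(\mathbf a\cdot{}^\alpha\mathbf b,\ \alpha\beta).$$ Presentations: a monoid $N$ has monoid presentation $\langle Y:S\rangle$ via $\psi$ if $\psi:Y^*\to N$ is a surjective monoid morphism from the free monoid $Y^*$ whose kernel $\{(u,v):u\psi=v\psi\}$ is the congruence on $Y^*$ generated by $S$. A semigroup $T$ has semigroup presentation $\langle X:R\rangle$, where $R\subseteq X^+\times X^+$, via $\phi$ if $\phi:X^+\to T$ is a surjective semigroup morphism from the free semigroup $X^+$ (non-empty words) whose kernel is the congruence on $X^+$ generated by $R$. A relation $(u,v)$ is written $u=v$. *)

theory Defs
  imports "HOL-Algebra.Product_Groups"
begin

section \<open>Presentations\<close>

definition free_monoid :: "'a set \<Rightarrow> 'a list monoid" where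
  "free_monoid A = \<lparr>carrier = lists A, mult = (@), one = []\<rparr>"

text \<open>Semigroups are given by the same records as monoids; their field \<^const>\<open>one\<close> is left
  unspecified and is never used.\<close>

definition free_semigroup :: "'a set \<Rightarrow> 'a list monoid" where
  "free_semigroup A = \<lparr>carrier = lists A - {[]}, mult = (@), one = undefined\<rparr>"

inductive_set generated_congruence ::
    "('a, 'm) monoid_scheme \<Rightarrow> ('a \<times> 'a) set \<Rightarrow> ('a \<times> 'a) set"
  for G (structure) and R where
  base: "(u, v) \<in> R \<Longrightarrow> (u, v) \<in> generated_congruence G R"
| refl: "u \<in> carrier G \<Longrightarrow> (u, u) \<in> generated_congruence G R"
| sym: "(u, v) \<in> generated_congruence G R \<Longrightarrow> (v, u) \<in> generated_congruence G R"
| trans: "(u, v) \<in> generated_congruence G R \<Longrightarrow> (v, w) \<in> generated_congruence G R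
    \<Longrightarrow> (u, w) \<in> generated_congruence G R"
| left: "(u, v) \<in> generated_congruence G R \<Longrightarrow> w \<in> carrier G
    \<Longrightarrow> (w \<otimes> u, w \<otimes> v) \<in> generated_congruence G R"
| right: "(u, v) \<in> generated_congruence G R \<Longrightarrow> w \<in> carrier G
    \<Longrightarrow> (u \<otimes> w, v \<otimes> w) \<in> generated_congruence G R"

definition kernel_on :: "'a set \<Rightarrow> ('a \<Rightarrow> 'b) \<Rightarrow> ('a \<times> 'a) set" where
  "kernel_on A h = {(u, v). u \<in> A \<and> v \<in> A \<and> h u = h v}"

definition has_monoid_presentation ::
    "('b, 'm) monoid_scheme \<Rightarrow> 'a set \<Rightarrow> ('a list \<times> 'a list) set \<Rightarrow> ('a list \<Rightarrow> 'b) \<Rightarrow> bool" where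
  "has_monoid_presentation N Y S \<psi> \<longleftrightarrow>
     S \<subseteq> carrier (free_monoid Y) \<times> carrier (free_monoid Y) \<and>
     \<psi> \<in> hom (free_monoid Y) N \<and> \<psi> \<one>\<^bsub>free_monoid Y\<^esub> = \<one>\<^bsub>N\<^esub> \<and>
     \<psi> ` carrier (free_monoid Y) = carrier N \<and>
     kernel_on (carrier (free_monoid Y)) \<psi> = generated_congruence (free_monoid Y) S"

definition has_semigroup_presentation ::
    "('b, 'm) monoid_scheme \<Rightarrow> 'a set \<Rightarrow> ('a list \<times> 'a list) set \<Rightarrow> ('a list \<Rightarrow> 'b) \<Rightarrow> bool" where
  "has_semigroup_presentation T X R \<phi> \<longleftrightarrow>
     R \<subseteq> carrier (free_semigroup X) \<times> carrier (free_semigroup X) \<and>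
     \<phi> \<in> hom (free_semigroup X) T \<and>
     \<phi> ` carrier (free_semigroup X) = carrier T \<and>
     kernel_on (carrier (free_semigroup X)) \<phi> = generated_congruence (free_semigroup X) R"

text \<open>The semigroup morphism determined by its values on letters; the empty word is not an
  element of the free semigroup, so the value there is left unspecified.\<close>

fun semigroup_extension :: "('b, 'm) monoid_scheme \<Rightarrow> ('a \<Rightarrow> 'b) \<Rightarrow> 'a list \<Rightarrow> 'b" where
  "semigroup_extension T g [a] = g a"
| "semigroup_extension T g (a # b # w) = g a \<otimes>\<^bsub>T\<^esub> semigroup_extension T g (b # w)"


section \<open>The singular wreath product\<close>

definition sym_inv_monoid :: "nat \<Rightarrow> (nat \<rightharpoonup> nat) set" where
  "sym_inv_monoid n = {\<alpha>. dom \<alpha> \<subseteq> {1..n} \<and> ran \<alpha> \<subseteq> {1..n} \<and> inj_on \<alpha> (dom \<alpha>)}"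

definition sym_grp :: "nat \<Rightarrow> (nat \<rightharpoonup> nat) set" where
  "sym_grp n = {\<alpha> \<in> sym_inv_monoid n. dom \<alpha> = {1..n} \<and> ran \<alpha> = {1..n}}"

definition Sing :: "nat \<Rightarrow> (nat \<rightharpoonup> nat) set" where
  "Sing n = sym_inv_monoid n - sym_grp n"

definition pid :: "'a set \<Rightarrow> 'a \<rightharpoonup> 'a" where
  "pid A = Some |` A"

definition adjoin_zero :: "('b, 'm) monoid_scheme \<Rightarrow> 'b option monoid" where
  "adjoin_zero M =
     \<lparr>carrier = insert None (Some ` carrier M),
      mult = (\<lambda>a b. case (a, b) of (Some x, Some y) \<Rightarrow> Some (x \<otimes>\<^bsub>M\<^esub> y) | _ \<Rightarrow> None),
      one = Some \<one>\<^bsub>M\<^esub>\<rparr>"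

text \<open>Despite its name, \<^const>\<open>product_group\<close> is the direct product of arbitrary monoid records.
  Tuples are extensional functions on \<open>{1..n}\<close>.\<close>

definition zero_power :: "('b, 'm) monoid_scheme \<Rightarrow> nat \<Rightarrow> (nat \<Rightarrow> 'b option) monoid" where
  "zero_power M n = product_group {1..n} (\<lambda>_. adjoin_zero M)"

definition supp :: "nat \<Rightarrow> (nat \<Rightarrow> 'b option) \<Rightarrow> nat set" where
  "supp n a = {i \<in> {1..n}. a i \<noteq> None}"

definition act :: "nat \<Rightarrow> (nat \<rightharpoonup> nat) \<Rightarrow> (nat \<Rightarrow> 'b option) \<Rightarrow> nat \<Rightarrow> 'b option" where
  "act n \<alpha> a = (\<lambda>i\<in>{1..n}. case \<alpha> i of Some j \<Rightarrow> a j | None \<Rightarrow> None)"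

text \<open>Partial maps compose from left to right, so the product of \<open>\<alpha>\<close> and \<open>\<beta>\<close> is \<open>\<beta> \<circ>\<^sub>m \<alpha>\<close>.\<close>

definition sing_wreath ::
    "('b, 'm) monoid_scheme \<Rightarrow> nat \<Rightarrow> ((nat \<Rightarrow> 'b option) \<times> (nat \<rightharpoonup> nat)) monoid" where
  "sing_wreath M n =
     \<lparr>carrier = {(a, \<alpha>). a \<in> carrier (zero_power M n) \<and> \<alpha> \<in> Sing n \<and> supp n a = dom \<alpha>},
      mult = (\<lambda>(a, \<alpha>) (b, \<beta>). (a \<otimes>\<^bsub>zero_power M n\<^esub> act n \<alpha> b, \<beta> \<circ>\<^sub>m \<alpha>)),
      one = undefined\<rparr>"


section \<open>Generators and relations\<close>

text \<open>\<open>F i j\<close>, \<open>E i\<close> and \<open>G x i j\<close> are the letters $f_{i,j}$, $e_i$ and $x^{(i;j)}$.\<close>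

datatype 'x letter = F nat nat | E nat | G 'x nat nat

definition alphabet :: "nat \<Rightarrow> 'x set \<Rightarrow> 'x letter set" where
  "alphabet n XM =
     {F i j | i j. i \<in> {1..n} \<and> j \<in> {1..n} \<and> i \<noteq> j} \<union>
     {E i | i. i \<in> {1..n}} \<union>
     {G x i j | x i j. x \<in> XM \<and> i \<in> {1..n} \<and> j \<in> {1..n} \<and> i \<noteq> j}"

definition lift_word :: "nat \<Rightarrow> nat \<Rightarrow> 'x list \<Rightarrow> 'x letter list" where
  "lift_word i j w = (if w = [] then [E j] else map (\<lambda>x. G x i j) w)"

text \<open>In the three groups below the indices range over all of \<open>nat\<close> and the letters over all of
  \<open>'x\<close>. The set \<open>relations\<close> keeps exactly those relations in which every letter is defined, that
  is, belongs to \<open>alphabet n XM\<close>. This supplies the conditions that indices lie in \<open>{1..n}\<close>, that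
  \<open>i \<noteq> j\<close> in \<open>F i j\<close> and \<open>G x i j\<close>, and that \<open>x \<in> XM\<close>. A chain \<open>u = v = w\<close> is entered as the
  two relations \<open>u = v\<close> and \<open>v = w\<close>.\<close>

inductive_set relations_A :: "('x letter list \<times> 'x letter list) set" where
  A1: "distinct [i, j] \<Longrightarrow> ([F i j, F j i, F i j], [F i j]) \<in> relations_A"
| A2a: "distinct [i, j] \<Longrightarrow> ([F i j, F i j, F i j], [F i j, F i j]) \<in> relations_A"
| A2b: "distinct [i, j] \<Longrightarrow> ([F i j, F i j], [F j i, F j i]) \<in> relations_A"
| A3: "distinct [i, j, k, l] \<Longrightarrow> ([F i j, F k l], [F k l, F i j]) \<in> relations_A"
| A4: "distinct [i, j, k] \<Longrightarrow> ([F i j, F j i], [F i k, F k i]) \<in> relations_A"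
| A5a: "distinct [i, j, k] \<Longrightarrow> ([F i j, F i k], [F j k, F i j]) \<in> relations_A"
| A5b: "distinct [i, j, k] \<Longrightarrow> ([F j k, F i j], [F i k, F j k]) \<in> relations_A"
| A6: "distinct [i, j, k] \<Longrightarrow> ([F k i, F i j, F j k], [F k j, F j i, F i k]) \<in> relations_A"
| A7: "distinct [i, j, k, l] \<Longrightarrow>
    ([F k i, F i j, F j k, F k l], [F k l, F l i, F i j, F j l]) \<in> relations_A"

inductive_set relations_B ::
    "('x list \<times> 'x list) set \<Rightarrow> ('x letter list \<times> 'x letter list) set"
  for RM where
  B1: "([E i, E i], [E i]) \<in> relations_B RM"
| B2: "([E i, E j], [E j, E i]) \<in> relations_B RM"
| B3: "(u, v) \<in> RM \<Longrightarrow> i \<noteq> j \<Longrightarrow> (lift_word i j u, lift_word i j v) \<in> relations_B RM"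
| B4a: "k \<noteq> i \<Longrightarrow> k \<noteq> j \<Longrightarrow> ([G x i j, E k], [E k, G x i j]) \<in> relations_B RM"
| B4b: "k \<noteq> i \<Longrightarrow> k \<noteq> j \<Longrightarrow> ([E k, G x i j], [E j, G x i k]) \<in> relations_B RM"
| B5a: "([G x i j, E j], [E j, G x i j]) \<in> relations_B RM"
| B5b: "([E j, G x i j], [G x i j]) \<in> relations_B RM"
| B6a: "([G x i j, E i], [E i, G x i j]) \<in> relations_B RM"
| B6b: "([E i, G x i j], [E i, E j]) \<in> relations_B RM"
| B7: "i \<noteq> j \<Longrightarrow> ([G x i k, G y j k], [G y j k, G x i k]) \<in> relations_B RM"

inductive_set relations_C :: "('x letter list \<times> 'x letter list) set" where
  C1: "([F i j, F j i], [E i]) \<in> relations_C"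
| C2: "([F i j, G x i j], [G x j i, F i j]) \<in> relations_C"
| C3: "([F i j, G x i k], [G x j k, F i j]) \<in> relations_C"
| C4: "([F i j, G x k i], [G x k i, E j]) \<in> relations_C"
| C5: "([F i j, G x j k], [F i j, F k j]) \<in> relations_C"
| C6: "([F i j, G x k j], [G x k i, F i j]) \<in> relations_C"
| C7: "{i, j} \<inter> {k, l} = {} \<Longrightarrow> ([F i j, G x k l], [G x k l, F i j]) \<in> relations_C"

definition relations ::
    "nat \<Rightarrow> 'x set \<Rightarrow> ('x list \<times> 'x list) set \<Rightarrow> ('x letter list \<times> 'x letter list) set" where
  "relations n XM RM =
     {(u, v) \<in> relations_A \<union> relations_B RM \<union> relations_C.
        set u \<subseteq> alphabet n XM \<and> set v \<subseteq> alphabet n XM}"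

fun letter_image ::
    "('b, 'm) monoid_scheme \<Rightarrow> ('x list \<Rightarrow> 'b) \<Rightarrow> nat \<Rightarrow> 'x letter
      \<Rightarrow> (nat \<Rightarrow> 'b option) \<times> (nat \<rightharpoonup> nat)" where
  "letter_image M \<phi>M n (F i j) =
     (\<lambda>k\<in>{1..n}. if k = i then None else Some \<one>\<^bsub>M\<^esub>, (pid ({1..n} - {i}))(j \<mapsto> i))"
| "letter_image M \<phi>M n (E i) =
     (\<lambda>k\<in>{1..n}. if k = i then None else Some \<one>\<^bsub>M\<^esub>, pid ({1..n} - {i}))"
| "letter_image M \<phi>M n (G x i j) =
     (\<lambda>k\<in>{1..n}. if k = i then Some (\<phi>M [x]) else if k = j then None else Some \<one>\<^bsub>M\<^esub>,
      pid ({1..n} - {j}))"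

end

theory Submission
  imports Defs "HOL-Combinatorics.Permutations"
begin

text \<open>
  A word over the alphabet moves the points \<open>1, \<dots>, n\<close>: the function \<open>path u\<close> tells for each point
  that it is lost, or where it ends and which product of elements of \<open>M\<close> it has picked up on its
  way. As the support of \<open>a\<close> is the domain of \<open>\<alpha>\<close> in every element \<open>(a, \<alpha>)\<close> of the wreath product,
  these functions are just the elements of the wreath product in another notation, and two words
  have the same image iff they have the same path. Every relation preserves paths; what has to
  be shown is that the relations allow any word to be recovered from its path
  (\<open>path_determines_eval\<close>).

  A word over singular letters loses some point \<open>h\<close> and misses some point \<open>k\<close> in its image, and the
  relations imply \<open>u = e\<^sub>h u e\<^sub>k\<close> for every word \<open>u\<close> with that path (\<open>e_word\<close>, \<open>word_e\<close>). Since
  \<open>f\<^sub>h\<^sub>k f\<^sub>k\<^sub>h = e\<^sub>h\<close>, words can be transported into the corner of all elements \<open>e\<^sub>h u e\<^sub>h\<close>. There \<open>h\<close> is a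
  hole as in a sliding puzzle: \<open>f\<^sub>h\<^sub>i f\<^sub>i\<^sub>j f\<^sub>j\<^sub>h\<close> exchanges the tokens at \<open>i\<close> and \<open>j\<close> and returns the
  hole to \<open>h\<close>. These swaps, the idempotents \<open>e\<^sub>i\<close> and the letters \<open>x\<close> with superscript \<open>(i;h)\<close>
  generate the corner, as one sees by reading a word from left to right while the hole moves
  (\<open>word_in_corner\<close>). Conjugation by a swap renames indices, so every element of the corner has the
  form \<open>e\<^sub>h D t\<close> with \<open>D\<close> a product of \<open>e\<^sub>i\<close>'s and \<open>x\<close>'s, and \<open>t\<close> a product of swaps.

  This form is unique as far as it has to be. The factors of \<open>D\<close> with different indices commute,
  those with one index are governed by the presentation of \<open>M\<close>, and \<open>e\<^sub>i\<close> acts as a zero among them,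
  so \<open>D\<close> is determined by its path (\<open>diag_eq\<close>). The swaps satisfy the relations of the
  transpositions in the symmetric group, and \<open>e\<^sub>i e\<^sub>j\<close> absorbs the swap of \<open>i\<close> and \<open>j\<close>; together these
  show that \<open>D\<close> absorbs every product of swaps that fixes all points which \<open>D\<close> keeps
  (\<open>swaps_absorbed\<close>). Two products of swaps that agree on these points differ by such a factor.

  The computations take place in an arbitrary monoid satisfying the relations. They apply to words
  modulo the relations because words act faithfully, by left multiplication, on the classes
  (\<open>universal_faithful\<close>).
\<close>

section \<open>Consequences of the relations\<close>

text \<open>In a right-associated product a rule \<open>a * b = c\<close> does not match below a further factor; this
  derives the version that does.\<close>

lemma mult_ctx:
  fixes a b c z :: "'q::monoid_mult"
  assumes "a * b = c"
  shows "a * (b * z) = c * z"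
  using assms by (metis mult.assoc)

text \<open>The setting of all equational reasoning: a map of the letters into a monoid under which the
  relations hold. Its unit only serves as value of the empty word.\<close>

locale wreath_relations =
  fixes n :: nat and XM :: "'x set" and RM :: "('x list \<times> 'x list) set"
    and val :: "'x letter \<Rightarrow> 'q::monoid_mult"
  assumes RM_words: "RM \<subseteq> lists XM \<times> lists XM"
    and relation_holds:
      "(u, v) \<in> relations n XM RM \<Longrightarrow> prod_list (map val u) = prod_list (map val v)"
begin

definition N where "N = {1..n}"
abbreviation f where "f i j \<equiv> val (F i j)"
abbreviation e where "e i \<equiv> val (E i)"
abbreviation g where "g x i j \<equiv> val (G x i j)"

lemma letter_in_alphabet [simp]:
  "F i j \<in> alphabet n XM \<longleftrightarrow> i \<in> N \<and> j \<in> N \<and> i \<noteq> j"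
  "E i \<in> alphabet n XM \<longleftrightarrow> i \<in> N"
  "G x i j \<in> alphabet n XM \<longleftrightarrow> x \<in> XM \<and> i \<in> N \<and> j \<in> N \<and> i \<noteq> j"
  by (auto simp: alphabet_def N_def)

lemma relation_rules:
  assumes "(u, v) \<in> relations_A \<or> (u, v) \<in> relations_B RM \<or> (u, v) \<in> relations_C"
    and "set u \<subseteq> alphabet n XM" "set v \<subseteq> alphabet n XM"
  shows "prod_list (map val u) = prod_list (map val v)"
  using assms relation_holds by (auto simp: relations_def)

lemma e_idem: "i \<in> N \<Longrightarrow> e i * e i = e i"
  using relation_rules[of "[E i, E i]" "[E i]"]
  by (simp add: relations_B.intros)

lemma e_comm: "i \<in> N \<Longrightarrow> j \<in> N \<Longrightarrow> e i * e j = e j * e i"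
  using relation_rules[of "[E i, E j]" "[E j, E i]"]
  by (simp add: relations_B.intros)

lemma f_f_back: "i \<in> N \<Longrightarrow> j \<in> N \<Longrightarrow> i \<noteq> j \<Longrightarrow> f i j * f j i = e i"
  using relation_rules[of "[F i j, F j i]" "[E i]"]
  by (simp add: relations_C.intros)

lemma e_f:
  assumes "i \<in> N" "j \<in> N" "i \<noteq> j"
  shows "e i * f i j = f i j"
proof -
  have "f i j * (f j i * f i j) = f i j"
    using relation_rules[of "[F i j, F j i, F i j]" "[F i j]"] assms
    by (simp add: relations_A.intros)
  then show ?thesis using f_f_back[OF assms] by (simp flip: mult.assoc)
qed

lemma f_e:
  assumes "i \<in> N" "j \<in> N" "i \<noteq> j"
  shows "f i j * e j = f i j"
proof -
  have "f i j * e j = f i j * f j i * f i j"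
    using f_f_back[of j i] assms by (simp add: mult.assoc)
  then show ?thesis using assms by (simp add: f_f_back e_f)
qed

text \<open>The three products on the left all equal \<open>f i j * f i j\<close>, since by \<open>f\<^sup>3 = f\<^sup>2\<close> and by the symmetry of
  \<open>f\<^sup>2\<close> in \<open>i\<close> and \<open>j\<close> longer words in \<open>f i j\<close> and \<open>f j i\<close> collapse.\<close>

lemma f_squared:
  assumes "i \<in> N" "j \<in> N" "i \<noteq> j"
  shows "f i j * f i j = e i * e j" "f i j * e i = e i * e j" "e j * f i j = e i * e j"
proof -
  have cubes: "f i j * (f i j * f i j) = f i j * f i j" "f j i * (f j i * f j i) = f i j * f i j"
    and square: "f j i * f j i = f i j * f i j"
    using relation_rules[of "[F i j, F i j, F i j]" "[F i j, F i j]"]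
      relation_rules[of "[F j i, F j i, F j i]" "[F j i, F j i]"]
      relation_rules[of "[F i j, F i j]" "[F j i, F j i]"] assms
    by (simp_all add: relations_A.intros)
  have es: "e i = f i j * f j i" "e j = f j i * f i j"
    using assms by (simp_all add: f_f_back)
  show sq: "f i j * f i j = e i * e j"
    unfolding es by (simp only: mult.assoc square[THEN mult_ctx] cubes)
  show "f i j * e i = e i * e j"
    unfolding sq[symmetric] unfolding es by (metis mult.assoc square cubes(2))
  show "e j * f i j = e i * e j"
    unfolding sq[symmetric] unfolding es by (metis mult.assoc square cubes(2))
qed

text \<open>Writing \<open>e k\<close> as \<open>f k i * f i k\<close> lets the two relations for pushing a token through an
  intermediate hole carry \<open>f i j\<close> across.\<close>

lemma f_e_disjoint:
  assumes "i \<in> N" "j \<in> N" "k \<in> N" "distinct [i, j, k]"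
  shows "f i j * e k = e k * f i j"
proof -
  have slide: "f a b * f a c = f b c * f a b" "f b c * f a b = f a c * f b c"
    if "a \<in> N" "b \<in> N" "c \<in> N" "distinct [a, b, c]" for a b c
    using relation_rules[of "[F a b, F a c]" "[F b c, F a b]"]
      relation_rules[of "[F b c, F a b]" "[F a c, F b c]"] that
    by (simp_all add: relations_A.intros)
  have "f i j * e k = f i j * f k i * f i k"
    using assms by (simp add: f_f_back mult.assoc)
  also have "\<dots> = f k j * (f i j * f i k)"
    using slide(2)[of k i j] assms by (simp add: mult.assoc)
  also have "\<dots> = f k j * f j k * f i j"
    using slide(1)[of i j k] assms by (simp add: mult.assoc)
  finally show ?thesis using assms by (simp add: f_f_back)
qed

lemma f_e_conj:
  assumes "i \<in> N" "j \<in> N" "i \<noteq> j" "k \<in> N"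
  shows "f i j * e k = e (transpose i j k) * f i j"
proof (cases "k = i \<or> k = j")
  case True
  then show ?thesis
    using assms f_squared(2,3)[of i j] f_e[of i j] e_f[of i j] by (elim disjE) simp_all
next
  case False
  then have "distinct [i, j, k]" using assms(3) by auto
  then show ?thesis using assms f_e_disjoint[of i j k] False by simp
qed

text \<open>With a hole at \<open>h\<close>: move the token at \<open>i\<close> to \<open>h\<close>, the one at \<open>j\<close> to \<open>i\<close>, and the one at \<open>h\<close> to
  \<open>j\<close>.\<close>

definition swap :: "nat \<Rightarrow> nat \<Rightarrow> nat \<Rightarrow> 'q" where
  "swap h i j = f h i * f i j * f j h"

lemma swap_commute:
  assumes "h \<in> N" "i \<in> N" "j \<in> N" "distinct [h, i, j]"
  shows "swap h i j = swap h j i"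
  using assms relation_rules[of "[F h i, F i j, F j h]" "[F h j, F j i, F i h]"]
  by (simp add: relations_A.intros swap_def mult.assoc)

lemma swap_swap:
  assumes "h \<in> N" "i \<in> N" "j \<in> N" "distinct [h, i, j]"
  shows "swap h i j * swap h i j = e h"
proof -
  have "swap h i j * swap h i j = f h i * f i j * (f j h * f h j) * f j i * f i h"
    by (subst (2) swap_commute[OF assms]) (simp add: swap_def mult.assoc)
  also have "\<dots> = f h i * (f i j * f j i) * f i h"
    using assms by (simp add: f_f_back f_e mult.assoc)
  also have "\<dots> = e h"
    using assms by (simp add: f_f_back f_e flip: mult.assoc)
  finally show ?thesis .
qed

text \<open>Moving the hole from \<open>h\<close> to \<open>k\<close> renames the tokens by the transposition of \<open>h\<close> and \<open>k\<close>. If \<open>h\<close> is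
  not swapped this is the relation with four distinct indices; otherwise cancelling
  \<open>f h k * f k h\<close> suffices.\<close>

lemma f_swap_conj:
  assumes "h \<in> N" "k \<in> N" "h \<noteq> k" "a \<in> N" "b \<in> N" "distinct [k, a, b]"
  shows "f h k * swap k a b = swap h (transpose h k a) (transpose h k b) * f h k"
proof -
  have meets: "f h k * swap k h b = swap h k b * f h k" if "b \<in> N" "distinct [h, k, b]" for b
  proof -
    have "f h k * swap k h b = e h * f h b * f b k"
      using assms that by (simp add: swap_def f_f_back flip: mult.assoc)
    also have "\<dots> = f h b * (f b k * f k h * f h k)"
      using assms that by (simp add: e_f f_e f_f_back mult.assoc)
    also have "\<dots> = swap h k b * f h k"
      using assms that swap_commute[of h k b] by (simp add: swap_def mult.assoc)
    finally show ?thesis .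
  qed
  consider "a = h" | "b = h" | "a \<noteq> h" "b \<noteq> h" by blast
  then show ?thesis
  proof cases
    case 1
    then show ?thesis using meets[of b] assms by (auto simp: transpose_def)
  next
    case 2
    then show ?thesis
      using meets[of a] swap_commute[of h k a] swap_commute[of k h a] assms
      by (auto simp: transpose_def)
  next
    case 3
    then show ?thesis
      using assms relation_rules[of "[F h a, F a b, F b h, F h k]" "[F h k, F k a, F a b, F b k]"]
      by (simp add: relations_A.intros swap_def mult.assoc transpose_def)
  qed
qed

lemma f_g_conj:
  assumes "h \<in> N" "k \<in> N" "h \<noteq> k" "x \<in> XM" "i \<in> N" "i \<noteq> k"
  shows "f h k * g x i k = g x (transpose h k i) h * f h k"
  using assms relation_rules[of "[F h k, G x h k]" "[G x k h, F h k]"]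
    relation_rules[of "[F h k, G x i k]" "[G x i h, F h k]"]
  by (cases "i = h") (simp_all add: relations_C.intros transpose_def)

lemma transpose_in: "i \<in> A \<Longrightarrow> j \<in> A \<Longrightarrow> k \<in> A \<Longrightarrow> transpose i j k \<in> A"
  by (simp add: transpose_def)

text \<open>The hole running around a triangle acts on tokens as a transposition. So each conjugation rule for
  a single \<open>f\<close>, applied three times, yields the conjugation rule for swaps.\<close>

lemma transpose_triangle:
  "distinct [h, i, j] \<Longrightarrow> transpose h i (transpose i j (transpose j h k)) = transpose i j k"
  by (auto simp: transpose_def)

lemma swap_e_conj:
  assumes "h \<in> N" "i \<in> N" "j \<in> N" "distinct [h, i, j]" "k \<in> N"
  shows "swap h i j * e k = e (transpose i j k) * swap h i j"
proof -
  have "swap h i j * e k =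
      e (transpose h i (transpose i j (transpose j h k))) * swap h i j"
    using assms unfolding swap_def
    by (simp add: transpose_in mult.assoc f_e_conj f_e_conj[THEN mult_ctx])
  then show ?thesis using transpose_triangle[OF assms(4)] by simp
qed

lemma swap_g_conj:
  assumes "h \<in> N" "i \<in> N" "j \<in> N" "distinct [h, i, j]" "k \<in> N" "k \<noteq> h" "x \<in> XM"
  shows "swap h i j * g x k h = g x (transpose i j k) h * swap h i j"
proof -
  have ne: "transpose j h k \<noteq> j" "transpose i j (transpose j h k) \<noteq> i"
    using assms by (auto simp: transpose_def)
  have "swap h i j * g x k h =
      g x (transpose h i (transpose i j (transpose j h k))) h * swap h i j"
    using assms ne unfolding swap_def
    by (simp add: transpose_in mult.assoc f_g_conj f_g_conj[THEN mult_ctx])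
  then show ?thesis using transpose_triangle[OF assms(4)] by simp
qed

lemma swap_swap_conj:
  assumes "h \<in> N" "i \<in> N" "j \<in> N" "distinct [h, i, j]" "k \<in> N" "l \<in> N" "distinct [h, k, l]"
  shows "swap h i j * swap h k l = swap h (transpose i j k) (transpose i j l) * swap h i j"
proof -
  have ne: "transpose j h k \<noteq> j" "transpose i j (transpose j h k) \<noteq> i"
     "transpose j h l \<noteq> j" "transpose i j (transpose j h l) \<noteq> i"
    using assms by (auto simp: transpose_def)
  have inj: "transpose a b c = transpose a b d \<longleftrightarrow> c = d" for a b c d :: nat
    by (metis transpose_involutory)
  have "swap h i j * swap h k l =
      f h i * (f i j * (f j h * swap h k l))"
    unfolding swap_def[of h i j] by (simp add: mult.assoc)
  also have "\<dots> = f h i * (f i j * (swap j (transpose j h k) (transpose j h l) * f j h))"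
    using assms by (simp add: f_swap_conj)
  also have "\<dots> = f h i * (swap i (transpose i j (transpose j h k)) (transpose i j (transpose j h l))
       * f i j) * f j h"
    using assms ne inj by (simp add: f_swap_conj transpose_in mult.assoc f_swap_conj[THEN mult_ctx])
  also have "\<dots> = swap h (transpose h i (transpose i j (transpose j h k)))
       (transpose h i (transpose i j (transpose j h l))) * swap h i j"
    using assms ne inj
    by (simp add: f_swap_conj transpose_in mult.assoc f_swap_conj[THEN mult_ctx] swap_def[of h i j])
  finally show ?thesis using transpose_triangle[OF assms(4)] by simp
qed

text \<open>When \<open>i\<close> and \<open>j\<close> are empty, there is nothing to exchange.\<close>

lemma swap_absorbed:
  assumes "h \<in> N" "i \<in> N" "j \<in> N" "distinct [h, i, j]"
  shows "e h * e i * e j * swap h i j = e h * e i * e j"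
proof -
  have "e h * e i * e j * swap h i j = e h * (e i * e j) * f h i * f i j * f j h"
    by (simp add: swap_def mult.assoc)
  also have "\<dots> = e h * e j * (e i * f h i) * f i j * f j h"
    using assms by (simp add: e_comm[of i j] mult.assoc)
  also have "\<dots> = e h * (e j * e h) * (e i * f i j) * f j h"
    using assms by (simp add: f_squared mult.assoc)
  also have "\<dots> = e h * e h * (e j * f i j) * f j h"
    using assms by (simp add: e_f e_comm[of j h] mult.assoc)
  also have "\<dots> = e h * e i * (e j * f j h)"
    using assms by (simp add: e_idem f_squared mult.assoc)
  also have "\<dots> = e i * (e h * f j h)"
    using assms by (simp add: e_f e_comm[of h i] mult.assoc)
  also have "\<dots> = e i * (e h * e j)"
    using assms by (simp add: f_squared e_comm[of j h])
  finally show ?thesis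
    using assms by (simp add: e_comm[of h i] mult.assoc)
qed

text \<open>Given a further hole \<open>h\<close>, an \<open>f\<close> that overwrites the token at \<open>i\<close> may as well delete it and then
  swap; the place \<open>j\<close> becomes empty either way.\<close>

lemma e_f_disjoint:
  assumes "h \<in> N" "i \<in> N" "j \<in> N" "distinct [h, i, j]"
  shows "e h * f i j = e h * e i * swap h i j"
proof -
  have "e h * e i * swap h i j = e h * (e i * f h i) * f i j * f j h"
    by (simp add: swap_def mult.assoc)
  also have "\<dots> = e h * (e i * f i j) * f j h"
    using assms e_idem f_squared(3)[of h i] by (simp add: mult.assoc e_idem[THEN mult_ctx])
  also have "\<dots> = f i j * (e h * f j h)"
    using assms f_e_disjoint[of i j h] by (simp add: e_f flip: mult.assoc)
  also have "\<dots> = f i j * e h"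
    using assms f_squared(3)[of j h] f_e by (simp flip: mult.assoc)
  finally show ?thesis using assms f_e_disjoint[of i j h] by simp
qed

lemma g_e:
  assumes "x \<in> XM" "i \<in> N" "j \<in> N" "i \<noteq> j"
  shows "e j * g x i j = g x i j" "g x i j * e j = g x i j"
    "e i * g x i j = e i * e j" "g x i j * e i = e i * e j"
  using assms relation_rules[of "[E j, G x i j]" "[G x i j]"]
    relation_rules[of "[G x i j, E j]" "[E j, G x i j]"]
    relation_rules[of "[E i, G x i j]" "[E i, E j]"]
    relation_rules[of "[G x i j, E i]" "[E i, G x i j]"]
  by (simp_all add: relations_B.intros)

lemma g_e_disjoint:
  assumes "x \<in> XM" "i \<in> N" "j \<in> N" "k \<in> N" "distinct [i, j, k]"
  shows "g x i j * e k = e k * g x i j" "e k * g x i j = e j * g x i k"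
  using assms relation_rules[of "[G x i j, E k]" "[E k, G x i j]"]
    relation_rules[of "[E k, G x i j]" "[E j, G x i k]"]
  by (simp_all add: relations_B.intros)

lemma g_g_comm:
  assumes "x \<in> XM" "y \<in> XM" "i \<in> N" "j \<in> N" "k \<in> N" "distinct [i, j, k]"
  shows "g x i k * g y j k = g y j k * g x i k"
  using assms relation_rules[of "[G x i k, G y j k]" "[G y j k, G x i k]"]
  by (simp add: relations_B.intros)

end

section \<open>The corner at a hole\<close>

text \<open>A pair \<open>(c, i)\<close> denotes a diagonal letter acting at the place \<open>i\<close>, where \<open>None\<close> stands for the zero
  adjoined to \<open>M\<close>.\<close>

fun entry :: "nat \<Rightarrow> 'x option \<times> nat \<Rightarrow> 'x letter" where
  "entry h (None, i) = E i"
| "entry h (Some x, i) = G x i h"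

definition diag_word :: "nat \<Rightarrow> ('x option \<times> nat) list \<Rightarrow> 'x letter list" where
  "diag_word h D = map (entry h) D"

definition swap_word :: "nat \<Rightarrow> (nat \<times> nat) list \<Rightarrow> 'x letter list" where
  "swap_word h ts = concat (map (\<lambda>(i, j). [F h i, F i j, F j h]) ts)"

text \<open>A word moving the hole from \<open>h\<close> to \<open>k\<close>.\<close>

definition hop :: "nat \<Rightarrow> nat \<Rightarrow> 'x letter list" where
  "hop h k = (if h = k then [E h] else [F h k])"

definition entries :: "'x set \<Rightarrow> nat set \<Rightarrow> ('x option \<times> nat) set" where
  "entries XM A = insert None (Some ` XM) \<times> A"

definition pairs :: "nat set \<Rightarrow> (nat \<times> nat) set" where
  "pairs A = {(i, j). i \<in> A \<and> j \<in> A \<and> i \<noteq> j}"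

lemma diag_word_simps [simp]:
  "diag_word h [] = []" "diag_word h (d # D) = entry h d # diag_word h D"
  "diag_word h (D @ D') = diag_word h D @ diag_word h D'"
  by (simp_all add: diag_word_def)

lemma swap_word_simps [simp]:
  "swap_word h [] = []" "swap_word h ((i, j) # ts) = F h i # F i j # F j h # swap_word h ts"
  "swap_word h (ts @ ts') = swap_word h ts @ swap_word h ts'"
  by (simp_all add: swap_word_def)

lemma entries_iff [simp]:
  "(c, i) \<in> entries XM A \<longleftrightarrow> (c = None \<or> c \<in> Some ` XM) \<and> i \<in> A"
  by (auto simp: entries_def)

lemma pairs_iff [simp]: "(i, j) \<in> pairs A \<longleftrightarrow> i \<in> A \<and> j \<in> A \<and> i \<noteq> j"
  by (simp add: pairs_def)

context wreath_relations
begin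

definition eval :: "'x letter list \<Rightarrow> 'q" where
  "eval w = prod_list (map val w)"

lemma eval_simps [simp]:
  "eval [] = 1" "eval (a # w) = val a * eval w" "eval (u @ v) = eval u * eval v"
  by (simp_all add: eval_def)

abbreviation P where "P h \<equiv> N - {h}"

lemma diag_word_letters:
  "h \<in> N \<Longrightarrow> D \<in> lists (entries XM (P h)) \<Longrightarrow> diag_word h D \<in> lists (alphabet n XM)"
  by (induction D) auto

lemma swap_word_letters:
  "h \<in> N \<Longrightarrow> ts \<in> lists (pairs (P h)) \<Longrightarrow> swap_word h ts \<in> lists (alphabet n XM)"
  by (induction ts) auto

text \<open>The normal forms at the hole \<open>h\<close>. By \<open>word_in_corner\<close> they exhaust the elements \<open>e h * u * e h\<close>.\<close>

definition corner :: "nat \<Rightarrow> 'q set" where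
  "corner h = {e h * eval (diag_word h D) * eval (swap_word h ts) | D ts.
     D \<in> lists (entries XM (P h)) \<and> ts \<in> lists (pairs (P h))}"

lemma cornerI:
  assumes "D \<in> lists (entries XM (P h))" "ts \<in> lists (pairs (P h))"
    "a = e h * eval (diag_word h D) * eval (swap_word h ts)"
  shows "a \<in> corner h"
  using assms unfolding corner_def by blast

lemma entry_e_comm:
  assumes "h \<in> N" "d \<in> entries XM (P h)" "k \<in> N"
  shows "val (entry h d) * e k = e k * val (entry h d)"
proof (cases d)
  case (Pair c i)
  show ?thesis
  proof (cases c)
    case None
    then show ?thesis using Pair assms e_comm by simp
  next
    case (Some x)
    then have "x \<in> XM" "i \<in> N" "i \<noteq> h" using Pair assms by auto
    then show ?thesis
      using Some Pair assms g_e[of x i h] g_e_disjoint(1)[of x i h k]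
      by (cases "k = i"; cases "k = h") simp_all
  qed
qed

lemma diag_e_comm:
  assumes "h \<in> N" "D \<in> lists (entries XM (P h))" "k \<in> N"
  shows "eval (diag_word h D) * e k = e k * eval (diag_word h D)"
  using assms(2)
proof (induction D)
  case (Cons d D)
  then show ?case using entry_e_comm[of h d k] assms by (simp add: mult.assoc) (simp flip: mult.assoc)
qed simp

lemma swap_entry_conj:
  assumes "h \<in> N" "(i, j) \<in> pairs (P h)" "(c, k) \<in> entries XM (P h)"
  shows "swap h i j * val (entry h (c, k)) = val (entry h (c, transpose i j k)) * swap h i j"
  using assms swap_e_conj[of h i j k] swap_g_conj[of h i j k] by (cases c) auto

lemma f_entry_conj:
  assumes "h \<in> N" "k \<in> N" "h \<noteq> k" "(c, i) \<in> entries XM (P k)"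
  shows "f h k * val (entry k (c, i)) = val (entry h (c, transpose h k i)) * f h k"
  using assms f_e_conj[of h k i] f_g_conj[of h k _ i] by (cases c) auto

lemma swap_as_eval: "eval (swap_word h ((i, j) # ts)) = swap h i j * eval (swap_word h ts)"
  by (simp add: swap_def mult.assoc)

lemma transpose_P: "i \<in> P h \<Longrightarrow> j \<in> P h \<Longrightarrow> k \<in> P h \<Longrightarrow> transpose i j k \<in> P h"
  by (rule transpose_in)

lemma swaps_entry_conj:
  assumes "h \<in> N" "ts \<in> lists (pairs (P h))" "(c, k) \<in> entries XM (P h)"
  shows "\<exists>k' \<in> P h. eval (swap_word h ts) * val (entry h (c, k)) =
    val (entry h (c, k')) * eval (swap_word h ts)"
  using assms(2)
proof (induction ts)
  case Nil
  then show ?case using assms by auto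
next
  case (Cons t ts)
  obtain i j where t: "t = (i, j)" by fastforce
  obtain k' where k': "k' \<in> P h"
    "eval (swap_word h ts) * val (entry h (c, k)) = val (entry h (c, k')) * eval (swap_word h ts)"
    using Cons by auto
  have "swap h i j * (val (entry h (c, k')) * eval (swap_word h ts))
      = val (entry h (c, transpose i j k')) * (swap h i j * eval (swap_word h ts))"
    using Cons.hyps(1) k'(1) assms t swap_entry_conj[of h i j c k'] by (auto simp flip: mult.assoc)
  then show ?case
    using k' Cons.hyps(1) transpose_P[of i h j k'] unfolding t swap_as_eval
    by (intro bexI[of _ "transpose i j k'"]) (auto simp: mult.assoc)
qed

lemma swaps_e_comm:
  assumes "h \<in> N" "ts \<in> lists (pairs (P h))"
  shows "eval (swap_word h ts) * e h = e h * eval (swap_word h ts)"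
  using assms(2)
proof (induction ts)
  case (Cons t ts)
  obtain i j where t: "t = (i, j)" by fastforce
  have "swap h i j * (e h * eval (swap_word h ts)) = e h * (swap h i j * eval (swap_word h ts))"
    using Cons.hyps(1) assms t swap_e_conj[of h i j h] by (auto simp flip: mult.assoc)
  then show ?case using Cons unfolding t swap_as_eval by (simp add: mult.assoc)
qed simp

lemma corner_e:
  assumes "h \<in> N" "a \<in> corner h"
  shows "a * e h = a"
proof -
  obtain D ts where D: "D \<in> lists (entries XM (P h))" "ts \<in> lists (pairs (P h))"
    "a = e h * eval (diag_word h D) * eval (swap_word h ts)"
    using assms(2) unfolding corner_def by blast
  have "a * e h = e h * (eval (diag_word h D) * e h) * eval (swap_word h ts)"
    using D assms by (simp add: mult.assoc swaps_e_comm)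
  also have "\<dots> = e h * e h * eval (diag_word h D) * eval (swap_word h ts)"
    using D(1) assms(1) by (simp add: mult.assoc diag_e_comm)
  finally show ?thesis using D(3) assms(1) by (simp add: e_idem)
qed

lemma e_corner: "h \<in> N \<Longrightarrow> e h \<in> corner h"
  by (rule cornerI[of "[]" _ "[]"]) simp_all

text \<open>A diagonal letter passes the swaps on its left at the price of a new index.\<close>

lemma corner_entry:
  assumes "h \<in> N" "a \<in> corner h" "d \<in> entries XM (P h)"
  shows "a * val (entry h d) \<in> corner h"
proof -
  obtain D ts where D: "D \<in> lists (entries XM (P h))" "ts \<in> lists (pairs (P h))"
    "a = e h * eval (diag_word h D) * eval (swap_word h ts)"
    using assms(2) unfolding corner_def by blast
  obtain c k where d: "d = (c, k)" by fastforce
  obtain k' where "k' \<in> P h" "eval (swap_word h ts) * val (entry h (c, k)) =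
    val (entry h (c, k')) * eval (swap_word h ts)"
    using swaps_entry_conj[of h ts c k] D assms d by auto
  then show ?thesis
    using D assms(3) unfolding d
    by (intro cornerI[of "D @ [(c, k')]" _ ts]) (auto simp: mult.assoc)
qed

lemma corner_swap:
  assumes "h \<in> N" "a \<in> corner h" "(i, j) \<in> pairs (P h)"
  shows "a * swap h i j \<in> corner h"
proof -
  obtain D ts where D: "D \<in> lists (entries XM (P h))" "ts \<in> lists (pairs (P h))"
    "a = e h * eval (diag_word h D) * eval (swap_word h ts)"
    using assms(2) unfolding corner_def by blast
  then show ?thesis
    using assms by (intro cornerI[of D _ "ts @ [(i, j)]"]) (auto simp: mult.assoc swap_def)
qed

lemma corner_mult:
  assumes "h \<in> N" "a \<in> corner h" "b \<in> corner h"
  shows "a * b \<in> corner h"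
proof -
  obtain D ts where D: "D \<in> lists (entries XM (P h))" "ts \<in> lists (pairs (P h))"
    "b = e h * eval (diag_word h D) * eval (swap_word h ts)"
    using assms(3) unfolding corner_def by blast
  have "c * eval (diag_word h D) \<in> corner h" if "c \<in> corner h" for c
    using D(1) that
  proof (induction D arbitrary: c)
    case (Cons d D)
    then show ?case using corner_entry[of h c d] assms by (simp flip: mult.assoc)
  qed simp
  moreover have "c * eval (swap_word h ts) \<in> corner h" if "c \<in> corner h" for c
    using D(2) that
  proof (induction ts arbitrary: c)
    case (Cons t ts)
    obtain i j where "t = (i, j)" by fastforce
    then show ?case
      using Cons corner_swap[of h c i j] assms unfolding \<open>t = (i, j)\<close> swap_as_eval
      by (simp flip: mult.assoc)
  qed simp
  ultimately show ?thesis
    using D(3) assms corner_e[of h a] by (simp flip: mult.assoc)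
qed

lemma f_diag_conj:
  assumes "h \<in> N" "k \<in> N" "h \<noteq> k" "D \<in> lists (entries XM (P k))"
  shows "\<exists>D' \<in> lists (entries XM (P h)).
    f h k * eval (diag_word k D) = eval (diag_word h D') * f h k"
  using assms(4)
proof (induction D)
  case Nil
  show ?case by (rule bexI[of _ "[]"]) simp_all
next
  case (Cons d D)
  obtain c i where d: "d = (c, i)" by fastforce
  obtain D' where D': "D' \<in> lists (entries XM (P h))"
    "f h k * eval (diag_word k D) = eval (diag_word h D') * f h k"
    using Cons by auto
  have "(c, transpose h k i) \<in> entries XM (P h)"
    using Cons.hyps(1) assms(1,2) unfolding d by (auto simp: transpose_def)
  moreover have "f h k * (val (entry k d) * eval (diag_word k D)) =
      val (entry h (c, transpose h k i)) * (f h k * eval (diag_word k D))"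
    using f_entry_conj[of h k c i] Cons.hyps(1) assms d by (simp flip: mult.assoc)
  ultimately show ?case
    using D' by (intro bexI[of _ "(c, transpose h k i) # D'"]) (auto simp: mult.assoc)
qed

lemma f_swaps_conj:
  assumes "h \<in> N" "k \<in> N" "h \<noteq> k" "ts \<in> lists (pairs (P k))"
  shows "\<exists>ts' \<in> lists (pairs (P h)).
    f h k * eval (swap_word k ts) = eval (swap_word h ts') * f h k"
  using assms(4)
proof (induction ts)
  case Nil
  show ?case by (rule bexI[of _ "[]"]) simp_all
next
  case (Cons t ts)
  obtain i j where t: "t = (i, j)" by fastforce
  obtain ts' where ts': "ts' \<in> lists (pairs (P h))"
    "f h k * eval (swap_word k ts) = eval (swap_word h ts') * f h k"
    using Cons by auto
  have ij: "(transpose h k i, transpose h k j) \<in> pairs (P h)"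
    using Cons.hyps(1) assms(1,2) unfolding t by (auto simp: transpose_def)
  have "f h k * (swap k i j * eval (swap_word k ts)) =
      swap h (transpose h k i) (transpose h k j) * (f h k * eval (swap_word k ts))"
    using f_swap_conj[of h k i j] Cons.hyps(1) assms t by (auto simp flip: mult.assoc)
  also have "\<dots> = eval (swap_word h ((transpose h k i, transpose h k j) # ts')) * f h k"
    unfolding swap_as_eval ts'(2) by (simp add: mult.assoc)
  finally show ?case
    unfolding t swap_as_eval[of k] using ts'(1) ij by (metis lists.Cons)
qed

text \<open>Normal forms at the hole \<open>k\<close> become normal forms at \<open>h\<close> with indices renamed.\<close>

lemma f_corner_conj:
  assumes "h \<in> N" "k \<in> N" "h \<noteq> k" "a \<in> corner k"
  shows "\<exists>b \<in> corner h. f h k * a = b * f h k"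
proof -
  obtain D ts where D: "D \<in> lists (entries XM (P k))" "ts \<in> lists (pairs (P k))"
    "a = e k * eval (diag_word k D) * eval (swap_word k ts)"
    using assms(4) unfolding corner_def by blast
  obtain D' where D': "D' \<in> lists (entries XM (P h))"
    "f h k * eval (diag_word k D) = eval (diag_word h D') * f h k"
    using f_diag_conj D assms by blast
  obtain ts' where ts': "ts' \<in> lists (pairs (P h))"
    "f h k * eval (swap_word k ts) = eval (swap_word h ts') * f h k"
    using f_swaps_conj D assms by blast
  have "f h k * a = e h * (f h k * eval (diag_word k D)) * eval (swap_word k ts)"
    using assms D(3) e_f f_e by (simp flip: mult.assoc)
  also have "\<dots> = e h * eval (diag_word h D') * (f h k * eval (swap_word k ts))"
    by (simp add: D'(2) mult.assoc)
  also have "\<dots> = e h * eval (diag_word h D') * eval (swap_word h ts') * f h k"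
    by (simp add: ts'(2) mult.assoc)
  finally show ?thesis using cornerI[OF D'(1) ts'(1) HOL.refl] by blast
qed

text \<open>A letter read while the hole is at \<open>k\<close> either moves the hole (only \<open>F k j\<close> does) or acts on the
  tokens in a way that the corner generators at \<open>k\<close> can express.\<close>

lemma letter_corner:
  assumes "k \<in> N" "a \<in> alphabet n XM"
  shows "\<exists>b \<in> corner k. \<exists>k' \<in> N. e k * val a = b * eval (hop k k')"
proof -
  have stay: ?thesis if "e k * val a \<in> corner k"
    using that assms(1) corner_e[of k "e k * val a"]
    by (intro bexI[of _ "e k * val a"] bexI[of _ k]) (auto simp: hop_def)
  have base: "e k * val (entry k d) \<in> corner k" if "d \<in> entries XM (P k)" for d
    using that assms e_corner corner_entry by blast
  show ?thesis
  proof (cases a)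
    case (F i j)
    then have ij: "i \<in> N" "j \<in> N" "i \<noteq> j" using assms by auto
    consider "i = k" | "i \<noteq> k" "j = k" | "distinct [k, i, j]" using ij(3) by auto
    then show ?thesis
    proof cases
      case 1
      then show ?thesis
        using F ij e_corner[of k] by (intro bexI[of _ "e k"] bexI[of _ j]) (auto simp: hop_def)
    next
      case 2
      then have "e k * val a = e k * val (entry k (None, i))"
        using F ij f_squared(3)[of i k] e_comm[of i k] by simp
      then show ?thesis using stay base[of "(None, i)"] ij 2 by simp
    next
      case 3
      then have "e k * val a = e k * val (entry k (None, i)) * swap k i j"
        using F ij assms e_f_disjoint[of k i j] by simp
      then show ?thesis
        using stay base[of "(None, i)"] ij 3 assms(1) corner_swap[of k _ i j] by simp
    qed
  next
    case (E i)
    then show ?thesis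
      using stay base[of "(None, i)"] e_corner[of k] assms e_idem[of k] by (cases "i = k") auto
  next
    case (G x i j)
    then have ij: "i \<in> N" "j \<in> N" "i \<noteq> j" "x \<in> XM" using assms by auto
    consider "i = k" | "i \<noteq> k" "j = k" | "distinct [k, i, j]" using ij(3) by auto
    then show ?thesis
    proof cases
      case 1
      then have "e k * val a = e k * val (entry k (None, j))" using G ij g_e(3)[of x i j] by simp
      then show ?thesis using stay base[of "(None, j)"] ij 1 by simp
    next
      case 2
      then show ?thesis using stay base[of "(Some x, i)"] G ij by simp
    next
      case 3
      then have "e k * val a = e j * (e k * g x i k)"
        using G ij assms g_e_disjoint(2)[of x i j k] g_e(1)[of x i k] by simp
      also have "\<dots> = e k * val (entry k (None, j)) * val (entry k (Some x, i))"
        using e_comm[of j k] assms ij by (simp flip: mult.assoc)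
      finally show ?thesis
        using stay base[of "(None, j)"] ij 3 assms(1) corner_entry[of k _ "(Some x, i)"] by simp
    qed
  qed
qed

lemma hop_hop:
  assumes "h \<in> N" "k \<in> N" "l \<in> N" "h \<noteq> k"
  shows "\<exists>b \<in> corner h. f h k * eval (hop k l) = b * eval (hop h l)"
proof -
  consider "l = k" | "l = h" | "distinct [h, k, l]" using assms(4) by auto
  then show ?thesis
  proof cases
    case 1
    then show ?thesis
      using assms e_corner[of h] by (intro bexI[of _ "e h"]) (simp_all add: hop_def e_f f_e)
  next
    case 2
    then show ?thesis
      using assms e_corner[of h]
      by (intro bexI[of _ "e h"]) (simp_all add: hop_def f_f_back e_idem)
  next
    case 3
    have "f h k * eval (hop k l) = f h k * (f k l * e l)"
      using assms 3 by (simp add: hop_def f_e)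
    also have "\<dots> = e h * swap h k l * eval (hop h l)"
      using assms 3 by (simp add: hop_def swap_def f_f_back e_f e_f[THEN mult_ctx] mult.assoc)
    finally show ?thesis using e_corner corner_swap[of h "e h" k l] assms 3 by auto
  qed
qed

lemma hop_letter:
  assumes "h \<in> N" "k \<in> N" "a \<in> alphabet n XM"
  shows "\<exists>b \<in> corner h. \<exists>k' \<in> N. eval (hop h k) * val a = b * eval (hop h k')"
proof (cases "h = k")
  case True
  then show ?thesis using letter_corner[of h a] assms by (simp add: hop_def)
next
  case False
  obtain b k' where b: "b \<in> corner k" "k' \<in> N" "e k * val a = b * eval (hop k k')"
    using letter_corner[of k a] assms by blast
  obtain b' where b': "b' \<in> corner h" "f h k * b = b' * f h k"
    using f_corner_conj[of h k b] b assms False by blast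
  obtain c where c: "c \<in> corner h" "f h k * eval (hop k k') = c * eval (hop h k')"
    using hop_hop[of h k k'] b(2) assms False by blast
  have "eval (hop h k) * val a = f h k * (e k * val a)"
    using assms False f_e[of h k] by (simp add: hop_def flip: mult.assoc)
  also have "\<dots> = b' * (f h k * eval (hop k k'))"
    by (simp add: b(3) b'(2) flip: mult.assoc)
  also have "\<dots> = b' * c * eval (hop h k')"
    by (simp add: c(2) mult.assoc)
  finally show ?thesis using corner_mult[OF assms(1) b'(1) c(1)] b(2) by blast
qed

text \<open>Reading a word from left to right and carrying the position of the hole, the contribution of each
  letter is moved back to the corner at \<open>h\<close>.\<close>

lemma hop_word:
  assumes "h \<in> N" "w \<in> lists (alphabet n XM)" "k \<in> N"
  shows "\<exists>b \<in> corner h. \<exists>k' \<in> N. eval (hop h k) * eval w = b * eval (hop h k')"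
  using assms(2,3)
proof (induction w arbitrary: k)
  case Nil
  have "eval (hop h k) = e h * eval (hop h k)"
    using assms(1) Nil by (simp add: hop_def e_idem e_f)
  then show ?case using e_corner[OF assms(1)] Nil by auto
next
  case (Cons a w)
  obtain b k' where b: "b \<in> corner h" "k' \<in> N" "eval (hop h k) * val a = b * eval (hop h k')"
    using hop_letter[of h k a] assms Cons by blast
  obtain c l where c: "c \<in> corner h" "l \<in> N" "eval (hop h k') * eval w = c * eval (hop h l)"
    using Cons.IH[OF b(2)] by blast
  have "eval (hop h k) * eval (a # w) = eval (hop h k) * val a * eval w"
    by (simp add: mult.assoc)
  also have "\<dots> = b * (eval (hop h k') * eval w)"
    by (simp add: b(3) mult.assoc)
  also have "\<dots> = b * c * eval (hop h l)"
    by (simp add: c(3) mult.assoc)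
  finally show ?case using corner_mult[OF assms(1) b(1) c(1)] c(2) by blast
qed

text \<open>If the hole ends at \<open>k \<noteq> h\<close>, the final \<open>e h\<close> empties \<open>h\<close> too, and the last move can be
  replaced by \<open>e k\<close>.\<close>

lemma word_in_corner:
  assumes "h \<in> N" "w \<in> lists (alphabet n XM)"
  shows "e h * eval w * e h \<in> corner h"
proof -
  obtain b k where b: "b \<in> corner h" "k \<in> N" "e h * eval w = b * eval (hop h k)"
    using hop_word[of h w h] assms by (auto simp: hop_def)
  show ?thesis
  proof (cases "h = k")
    case True
    then have "e h * eval w * e h = b"
      using b corner_e[of h b] assms by (simp add: hop_def)
    then show ?thesis using b(1) by simp
  next
    case False
    then have "e h * eval w * e h = b * e h * val (entry h (None, k))"
      using b(2,3) f_squared(2)[of h k] assms by (simp add: hop_def mult.assoc)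
    then show ?thesis
      using b(1,2) corner_e[of h b] corner_entry[of h b "(None, k)"] assms False by simp
  qed
qed

end

section \<open>Words as weighted partial injections\<close>

locale presented_monoid = Group.monoid M for M (structure) +
  fixes XM :: "'x set" and RM :: "('x list \<times> 'x list) set" and \<phi>M :: "'x list \<Rightarrow> 'a"
  assumes presentation: "has_monoid_presentation M XM RM \<phi>M"
begin

lemma RM_in_lists: "RM \<subseteq> lists XM \<times> lists XM"
  using presentation by (simp add: has_monoid_presentation_def free_monoid_def)

lemma \<phi>M_closed: "u \<in> lists XM \<Longrightarrow> \<phi>M u \<in> carrier M"
  using presentation by (auto simp: has_monoid_presentation_def free_monoid_def hom_def)

lemma \<phi>M_Nil: "\<phi>M [] = \<one>"
  using presentation by (simp add: has_monoid_presentation_def free_monoid_def)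

lemma \<phi>M_append: "u \<in> lists XM \<Longrightarrow> v \<in> lists XM \<Longrightarrow> \<phi>M (u @ v) = \<phi>M u \<otimes> \<phi>M v"
  using presentation by (simp add: has_monoid_presentation_def free_monoid_def hom_def)

lemma \<phi>M_Cons: "x \<in> XM \<Longrightarrow> u \<in> lists XM \<Longrightarrow> \<phi>M (x # u) = \<phi>M [x] \<otimes> \<phi>M u"
  using \<phi>M_append[of "[x]" u] by simp

lemma \<phi>M_surj: "m \<in> carrier M \<Longrightarrow> \<exists>u \<in> lists XM. m = \<phi>M u"
  using presentation by (auto simp: has_monoid_presentation_def free_monoid_def)

lemma \<phi>M_kernel:
  "u \<in> lists XM \<Longrightarrow> v \<in> lists XM \<Longrightarrow>
    \<phi>M u = \<phi>M v \<longleftrightarrow> (u, v) \<in> generated_congruence (free_monoid XM) RM"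
  using presentation
  by (auto simp: has_monoid_presentation_def free_monoid_def kernel_on_def set_eq_iff)

text \<open>The effect of a letter on a point, as the weight and the target, or \<open>None\<close> if the point is lost.
  Points outside \<open>{1..n}\<close> are fixed, which keeps \<open>n\<close> out of the definition.\<close>

primrec step :: "'x letter \<Rightarrow> nat \<Rightarrow> ('a \<times> nat) option" where
  "step (F i j) p = (if p = i then None else Some (\<one>, if p = j then i else p))"
| "step (E i) p = (if p = i then None else Some (\<one>, p))"
| "step (G x i j) p = (if p = j then None else Some (if p = i then \<phi>M [x] else \<one>, p))"

definition seq :: "(nat \<Rightarrow> ('a \<times> nat) option) \<Rightarrow> (nat \<Rightarrow> ('a \<times> nat) option)
    \<Rightarrow> nat \<Rightarrow> ('a \<times> nat) option" where
  "seq s t p = (case s p of None \<Rightarrow> None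
    | Some (m, q) \<Rightarrow> (case t q of None \<Rightarrow> None | Some (m', r) \<Rightarrow> Some (m \<otimes> m', r)))"

primrec path :: "'x letter list \<Rightarrow> nat \<Rightarrow> ('a \<times> nat) option" where
  "path [] = (\<lambda>p. Some (\<one>, p))"
| "path (a # w) = seq (step a) (path w)"

lemma seq_None: "s p = None \<Longrightarrow> seq s t p = None"
  by (simp add: seq_def)

lemma seq_Some:
  "s p = Some (m, q) \<Longrightarrow>
    seq s t p = (case t q of None \<Rightarrow> None | Some (m', r) \<Rightarrow> Some (m \<otimes> m', r))"
  by (simp add: seq_def)

lemma step_closed: "a \<in> alphabet n XM \<Longrightarrow> step a p = Some (m, q) \<Longrightarrow> m \<in> carrier M"
  by (cases a) (auto simp: alphabet_def \<phi>M_closed split: if_splits)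

lemma path_closed: "w \<in> lists (alphabet n XM) \<Longrightarrow> path w p = Some (m, q) \<Longrightarrow> m \<in> carrier M"
proof (induction w arbitrary: p m q)
  case (Cons a w)
  then show ?case
    using step_closed[of a n p] by (auto simp: seq_def split: option.splits)
qed simp

lemma seq_assoc:
  assumes "\<And>p m q. s p = Some (m, q) \<Longrightarrow> m \<in> carrier M"
    "\<And>p m q. t p = Some (m, q) \<Longrightarrow> m \<in> carrier M"
    "\<And>p m q. r p = Some (m, q) \<Longrightarrow> m \<in> carrier M"
  shows "seq (seq s t) r = seq s (seq t r)"
proof
  fix p
  show "seq (seq s t) r p = seq s (seq t r) p"
    using assms by (simp add: seq_def m_assoc split: option.split)
qed

lemma path_append:
  assumes "u \<in> lists (alphabet n XM)" "v \<in> lists (alphabet n XM)"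
  shows "path (u @ v) = seq (path u) (path v)"
  using assms
proof (induction u)
  case Nil
  show ?case
  proof
    fix p
    show "path ([] @ v) p = seq (path []) (path v) p"
      using path_closed[OF assms(2), of p] by (auto simp: seq_def split: option.splits)
  qed
next
  case (Cons a u)
  then show ?case
    using seq_assoc[of "step a" "path u" "path v"] step_closed[of a n] path_closed[of u n]
      path_closed[of v n] by simp
qed

lemma path_letter:
  assumes "a \<in> alphabet n XM"
  shows "path [a] = step a"
proof
  fix p
  show "path [a] p = step a p"
    using step_closed[OF assms, of p] by (auto simp: seq_def split: option.splits)
qed

end

section \<open>Holes of a word\<close>

text \<open>In this setting equal products have equal paths, so facts about permutations can be read off from
  identities between products.\<close>

locale faithful_relations = presented_monoid M XM RM \<phi>M + wreath_relations n XM RM val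
  for M :: "('b, 'm) monoid_scheme" (structure) and XM :: "'x set" and RM and \<phi>M and n
    and val :: "'x letter \<Rightarrow> 'q::monoid_mult" +
  assumes sound: "u \<in> lists (alphabet n XM) \<Longrightarrow> v \<in> lists (alphabet n XM) \<Longrightarrow>
    eval u = eval v \<Longrightarrow> path u = path v"
begin

abbreviation words where "words \<equiv> lists (alphabet n XM)"

lemma e_letter:
  assumes "a \<in> alphabet n XM" "p \<in> N" "step a p = None"
  shows "e p * val a = val a"
  using assms e_idem e_f g_e(1) by (cases a) (auto split: if_splits)

lemma e_slides:
  assumes "a \<in> alphabet n XM" "p \<in> N" "step a p = Some (m, q)"
  shows "q \<in> N" "e p * val a = val a * e q"
proof -
  have "q \<in> N \<and> e p * val a = val a * e q"
  proof (cases a)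
    case (F i j)
    then show ?thesis
      using assms f_squared(2,3)[of i j] f_e_disjoint[of i j p] by (cases "p = j") (auto split: if_splits)
  next
    case (E i)
    then show ?thesis using assms e_comm[of i p] by (auto split: if_splits)
  next
    case (G x i j)
    then show ?thesis
      using assms g_e(3,4)[of x i j] g_e_disjoint(1)[of x i j p]
      by (cases "p = i") (auto split: if_splits)
  qed
  then show "q \<in> N" "e p * val a = val a * e q" by auto
qed

lemma letter_e:
  assumes "a \<in> alphabet n XM" "k \<in> N" "\<And>p m. step a p \<noteq> Some (m, k)"
  shows "val a * e k = val a"
proof (cases a)
  case (F i j)
  then have "k = j" using assms(3)[of k \<one>] assms(3)[of j \<one>] assms(1) by (auto split: if_splits)
  then show ?thesis using F assms f_e by simp
next
  case (E i)
  then have "k = i" using assms(3)[of k \<one>] by (auto split: if_splits)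
  then show ?thesis using E assms(2) e_idem by simp
next
  case (G x i j)
  then have "k = j" using assms(3)[of k \<one>] assms(3)[of k "\<phi>M [x]"] assms(1) by (auto split: if_splits)
  then show ?thesis using G assms g_e(2)[of x i j] by auto
qed

text \<open>A point that gets lost may be deleted at once: the idempotent at that point is pushed through the
  word, following the point, until the letter that loses it absorbs the idempotent.\<close>

lemma e_word:
  assumes "w \<in> words" "p \<in> N" "path w p = None"
  shows "e p * eval w = eval w"
  using assms
proof (induction w arbitrary: p)
  case (Cons a w)
  show ?case
  proof (cases "step a p")
    case None
    then show ?thesis using e_letter[of a p] Cons by (simp flip: mult.assoc)
  next
    case (Some mq)
    obtain m q where mq: "mq = (m, q)" by fastforce
    then have q: "q \<in> N" "e p * val a = val a * e q" using e_slides[of a p m q] Some Cons by auto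
    moreover have "path w q = None" using Cons Some mq by (auto simp: seq_def split: option.splits)
    ultimately have "e q * eval w = eval w" using Cons by auto
    then show ?thesis using q(2) by (simp flip: mult.assoc) (simp add: mult.assoc)
  qed
qed simp

text \<open>Dually, the idempotent is pushed to the left along the point from which \<open>k\<close> would have to come,
  until a letter has no such point and absorbs it.\<close>

lemma word_e:
  assumes "w \<in> words" "k \<in> N" "\<And>p m. path w p \<noteq> Some (m, k)"
  shows "eval w * e k = eval w"
  using assms
proof (induction w arbitrary: k rule: rev_induct)
  case (snoc a w)
  have a: "a \<in> alphabet n XM" "w \<in> words" using snoc.prems by auto
  have path: "path (w @ [a]) = seq (path w) (step a)"
    using path_append[of w n "[a]"] path_letter[of a n] a by simp
  show ?case
  proof (cases "\<exists>p m. step a p = Some (m, k)")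
    case False
    then show ?thesis using letter_e[of a k] a snoc by (simp add: mult.assoc)
  next
    case True
    then obtain l m where l: "step a l = Some (m, k)" by auto
    then have "l \<in> N" using a snoc.prems(2) by (cases a) (auto split: if_splits)
    moreover have "path w p \<noteq> Some (m', l)" for p m'
      using snoc.prems(3)[of p "m' \<otimes> m"] l by (auto simp: path seq_def)
    ultimately have "eval w * e l = eval w" using snoc.IH a by blast
    moreover have "eval w * val a * e k = eval w * e l * val a"
      using e_slides(2)[OF a(1) \<open>l \<in> N\<close> l] by (simp add: mult.assoc)
    ultimately show ?thesis by simp
  qed
next
  case Nil
  then show ?case using Nil.prems(3)[of k \<one>] by simp
qed

end

section \<open>The diagonal part\<close>

definition letters_at :: "nat \<Rightarrow> ('x option \<times> nat) list \<Rightarrow> 'x list" where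
  "letters_at p D = map (the \<circ> fst) (filter (\<lambda>d. snd d = p) D)"

lemma letters_at_simps [simp]:
  "letters_at p [] = []"
  "letters_at p ((c, i) # D) = (if i = p then the c # letters_at p D else letters_at p D)"
  by (simp_all add: letters_at_def)

lemma letters_at_filter:
  "letters_at p (filter (\<lambda>d. snd d = p) D) = letters_at p D"
  "p \<noteq> i \<Longrightarrow> letters_at p (filter (\<lambda>d. snd d \<noteq> i) D) = letters_at p D"
  by (induction D) (auto simp: letters_at_def)

lemma letters_at_lists:
  "D \<in> lists (entries XM A) \<Longrightarrow> (None, p) \<notin> set D \<Longrightarrow> letters_at p D \<in> lists XM"
proof (induction D)
  case (Cons d D)
  then show ?case by (cases d) auto
qed simp

lemma filter_entries:
  assumes "D \<in> lists (entries XM A)" "\<And>j. j \<in> A \<Longrightarrow> q j \<Longrightarrow> j \<in> B"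
  shows "filter (\<lambda>d. q (snd d)) D \<in> lists (entries XM B)"
  using assms(1)
proof (induction D)
  case (Cons d D)
  then show ?case using assms(2) by (cases d) auto
qed simp

lemma entries_lists_mono:
  "D \<in> lists (entries XM A) \<Longrightarrow> A \<subseteq> B \<Longrightarrow> D \<in> lists (entries XM B)"
  using filter_entries[of D XM A "\<lambda>_. True" B] by auto

text \<open>Words act on the right, so the first pair acts first.\<close>

definition perm :: "(nat \<times> nat) list \<Rightarrow> nat \<Rightarrow> nat" where
  "perm ts = fold (\<lambda>(i, j). transpose i j) ts"

lemma perm_simps [simp]:
  "perm [] p = p" "perm ((i, j) # ts) p = perm ts (transpose i j p)"
  "perm (ts @ ts') p = perm ts' (perm ts p)"
  by (simp_all add: perm_def)

lemma perm_rev: "perm (rev ts) (perm ts p) = p"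
  by (induction ts arbitrary: p) auto

lemma perm_fixes: "ts \<in> lists (pairs A) \<Longrightarrow> p \<notin> A \<Longrightarrow> perm ts p = p"
proof (induction ts)
  case (Cons t ts)
  then show ?case by (cases t) (auto simp: transpose_def)
qed simp

context presented_monoid
begin

lemma step_entry:
  "p \<noteq> h \<Longrightarrow> step (entry h (c, i)) p = (if p = i then map_option (\<lambda>x. (\<phi>M [x], p)) c else Some (\<one>, p))"
  by (cases c) auto

lemma path_diag:
  assumes "D \<in> lists (entries XM A)" "p \<noteq> h"
  shows "path (diag_word h D) p =
    (if (None, p) \<in> set D then None else Some (\<phi>M (letters_at p D), p))"
  using assms(1)
proof (induction D)
  case Nil
  then show ?case by (simp add: \<phi>M_Nil)
next
  case (Cons d D)
  obtain c i where d: "d = (c, i)" by fastforce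
  have "(None, p) \<notin> set D \<Longrightarrow> letters_at p D \<in> lists XM"
    using letters_at_lists[of D XM A p] Cons by auto
  then show ?case
    using Cons assms(2) d \<phi>M_closed[of "letters_at p D"] \<phi>M_Cons[of _ "letters_at p D"]
    by (cases c) (auto simp: seq_def step_entry split: if_splits)
qed

lemma path_swaps:
  assumes "ts \<in> lists (pairs A)" "h \<notin> A" "p \<noteq> h"
  shows "path (swap_word h ts) p = Some (\<one>, perm ts p)"
  using assms(1,3)
proof (induction ts arbitrary: p)
  case (Cons t ts)
  obtain i j where t: "t = (i, j)" by fastforce
  then have ij: "i \<noteq> h" "j \<noteq> h" "i \<noteq> j" using Cons assms(2) by auto
  have "transpose i j p \<noteq> h" using ij Cons.prems by (simp add: transpose_def)
  then have IH: "path (swap_word h ts) (transpose i j p) = Some (\<one>, perm ts (transpose i j p))"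
    using Cons.IH by blast
  consider "p = i" | "p = j" | "p \<noteq> i" "p \<noteq> j" by blast
  then show ?case
    by cases (use IH ij Cons.prems t in \<open>simp_all add: seq_def\<close>)
qed simp

end

context faithful_relations
begin

lemma path_normal:
  assumes h: "h \<in> N" and D: "D \<in> lists (entries XM (P h))" "ts \<in> lists (pairs (P h))"
  shows "path (E h # diag_word h D @ swap_word h ts) p =
    (if p = h \<or> (None, p) \<in> set D then None else Some (\<phi>M (letters_at p D), perm ts p))"
proof -
  have w: "diag_word h D \<in> words" "swap_word h ts \<in> words"
    using diag_word_letters[OF h D(1)] swap_word_letters[OF h D(2)] .
  have "(None, p) \<notin> set D \<Longrightarrow> \<phi>M (letters_at p D) \<in> carrier M"
    using letters_at_lists[OF D(1)] \<phi>M_closed by blast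
  then show ?thesis
    using path_diag[OF D(1), of p h] path_swaps[OF D(2), of h p]
    unfolding path.simps path_append[OF w] by (simp add: seq_def)
qed

lemma entry_comm:
  assumes "h \<in> N" "(c, i) \<in> entries XM (P h)" "(d, j) \<in> entries XM (P h)" "i \<noteq> j"
  shows "val (entry h (c, i)) * val (entry h (d, j)) = val (entry h (d, j)) * val (entry h (c, i))"
proof (cases c)
  case None
  then show ?thesis using entry_e_comm[of h "(d, j)" i] assms by simp
next
  case (Some x)
  show ?thesis
  proof (cases d)
    case None
    then show ?thesis using entry_e_comm[of h "(c, i)" j] assms by simp
  next
    case (Some y)
    then show ?thesis using \<open>c = Some x\<close> g_g_comm[of x y i j h] assms by auto
  qed
qed

lemma diag_entry_comm:
  assumes "h \<in> N" "(c, i) \<in> entries XM (P h)" "D \<in> lists (entries XM (P h - {i}))"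
  shows "val (entry h (c, i)) * eval (diag_word h D) = eval (diag_word h D) * val (entry h (c, i))"
  using assms(3)
proof (induction D)
  case (Cons d D)
  obtain c' j where d: "d = (c', j)" by fastforce
  have "val (entry h (c, i)) * val (entry h d) = val (entry h d) * val (entry h (c, i))"
    using entry_comm[of h c i c' j] Cons.hyps(1) assms d by auto
  then have "val (entry h (c, i)) * eval (diag_word h (d # D)) =
      val (entry h d) * (val (entry h (c, i)) * eval (diag_word h D))"
    by (simp flip: mult.assoc)
  also have "\<dots> = eval (diag_word h (d # D)) * val (entry h (c, i))"
    unfolding Cons.IH by (simp add: mult.assoc)
  finally show ?case .
qed simp

lemma diag_split:
  assumes "h \<in> N" "D \<in> lists (entries XM (P h))"
  shows "eval (diag_word h D) = eval (diag_word h (filter (\<lambda>d. snd d = i) D)) *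
    eval (diag_word h (filter (\<lambda>d. snd d \<noteq> i) D))"
  using assms(2)
proof (induction D)
  case (Cons d D)
  obtain c j where d: "d = (c, j)" by fastforce
  show ?case
  proof (cases "j = i")
    case True
    then show ?thesis using Cons d by (simp add: mult.assoc)
  next
    case False
    let ?C = "filter (\<lambda>d. snd d = i) D"
    have "?C \<in> lists (entries XM (P h - {j}))"
      using filter_entries[OF Cons.hyps(2), of "\<lambda>j. j = i" "P h - {j}"] False by blast
    then have "val (entry h d) * eval (diag_word h ?C) = eval (diag_word h ?C) * val (entry h d)"
      using diag_entry_comm[of h c j ?C] Cons.hyps(1) assms(1) d by simp
    then have "eval (diag_word h (d # D)) =
        eval (diag_word h ?C) * (val (entry h d) * eval (diag_word h (filter (\<lambda>d. snd d \<noteq> i) D)))"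
      using Cons.IH by (simp flip: mult.assoc)
    then show ?thesis using d False by simp
  qed
qed simp

text \<open>A relation of \<open>M\<close> with an empty side is lifted with the letter \<open>e h\<close> in its place; the factor \<open>e h\<close>
  in front makes this uniform.\<close>

lemma lift_congruence:
  assumes "h \<in> N" "i \<in> P h" "(u, v) \<in> generated_congruence (free_monoid XM) RM"
  shows "u \<in> lists XM \<and> v \<in> lists XM \<and>
    e h * eval (map (\<lambda>x. G x i h) u) = e h * eval (map (\<lambda>x. G x i h) v)"
proof -
  let ?lift = "\<lambda>u. map (\<lambda>x. G x i h) u"
  have comm: "eval (?lift w) * e h = e h * eval (?lift w)" if "w \<in> lists XM" for w
  proof -
    have "map (\<lambda>x. (Some x, i)) w \<in> lists (entries XM (P h))"
      using that assms(2) by (induction w) auto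
    then show ?thesis
      using diag_e_comm[of h "map (\<lambda>x. (Some x, i)) w" h] assms(1)
      by (simp add: diag_word_def comp_def)
  qed
  have lift: "eval (lift_word i h w) = e h * eval (?lift w)" if "w \<in> lists XM" for w
    using that assms(1,2) g_e(1)[of _ i h]
    by (cases w) (auto simp: lift_word_def simp flip: mult.assoc)
  have letters: "lift_word i h w \<in> words" if "w \<in> lists XM" for w
    using that assms(1,2) by (auto simp: lift_word_def)
  show ?thesis using assms(3)
  proof induction
    case (base u v)
    then have uv: "u \<in> lists XM" "v \<in> lists XM" using RM_in_lists by auto
    have "eval (lift_word i h u) = eval (lift_word i h v)"
      unfolding eval_def using relations_B.B3[OF base] assms(2) letters uv
      by (intro relation_rules) auto
    then show ?case using uv lift by simp
  next
    case (left u v w)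
    then have w: "w \<in> lists XM" by (simp add: free_monoid_def)
    have IH: "e h * eval (?lift u) = e h * eval (?lift v)" using left.IH by blast
    have "e h * eval (?lift (w @ u)) = eval (?lift w) * (e h * eval (?lift u))"
      using comm[OF w] by (simp flip: mult.assoc)
    also have "\<dots> = e h * eval (?lift (w @ v))"
      unfolding IH using comm[OF w] by (simp flip: mult.assoc)
    finally show ?case using left.IH w by (simp add: free_monoid_def)
  next
    case (right u v w)
    have IH: "e h * eval (?lift u) = e h * eval (?lift v)" using right.IH by blast
    have "e h * eval (?lift (u @ w)) = e h * eval (?lift u) * eval (?lift w)"
      by (simp add: mult.assoc)
    also have "\<dots> = e h * eval (?lift (v @ w))" unfolding IH by (simp add: mult.assoc)
    finally show ?case using right by (simp add: free_monoid_def)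
  qed (auto simp: free_monoid_def)
qed

lemma diag_zero:
  assumes "h \<in> N" "D \<in> lists (entries XM (P h))" "(None, i) \<in> set D"
  shows "eval (diag_word h D) * e i = eval (diag_word h D)"
proof -
  obtain D1 D2 where D: "D = D1 @ (None, i) # D2" using assms(3) by (auto simp: in_set_conv_decomp)
  then have i: "i \<in> N" and D2: "D2 \<in> lists (entries XM (P h))" using assms(2) by auto
  have "eval (diag_word h D) * e i = eval (diag_word h D1) * (e i * e i) * eval (diag_word h D2)"
    using diag_e_comm[OF assms(1) D2 i] D by (simp add: mult.assoc)
  then show ?thesis using e_idem[OF i] D by (simp add: mult.assoc)
qed

lemma column_zero:
  assumes "h \<in> N" "i \<in> P h" "D \<in> lists (entries XM {i})"
  shows "e h * e i * eval (diag_word h D) = e h * e i"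
  using assms(3)
proof (induction D)
  case (Cons d D)
  obtain c where d: "d = (c, i)" using Cons.hyps(1) by (cases d) auto
  have "e h * e i * val (entry h d) = e h * e i"
  proof (cases c)
    case None
    then show ?thesis using d assms e_idem by (simp add: mult.assoc)
  next
    case (Some x)
    have "e h * e i * val (entry h d) = e h * (e i * e h)"
      using Some d Cons.hyps(1) assms g_e(3)[of x i h] by (auto simp: mult.assoc)
    also have "\<dots> = e h * e h * e i" using assms e_comm[of i h] by (simp add: mult.assoc)
    finally show ?thesis using assms e_idem by simp
  qed
  then show ?case using Cons.IH by (simp flip: mult.assoc)
qed simp

text \<open>Letters with a single index: \<open>e i\<close> is a zero for them, and without it they form a lifted word of
  \<open>M\<close>.\<close>

lemma column_eq:
  assumes "h \<in> N" "i \<in> P h" "D \<in> lists (entries XM {i})" "D' \<in> lists (entries XM {i})"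
    "path (diag_word h D) i = path (diag_word h D') i"
  shows "e h * eval (diag_word h D) = e h * eval (diag_word h D')"
proof -
  have sub: "D \<in> lists (entries XM (P h))" if "D \<in> lists (entries XM {i})" for D
    using entries_lists_mono[OF that, of "P h"] assms(2) by blast
  have zero: "e h * eval (diag_word h D) = e h * e i"
    if D: "D \<in> lists (entries XM {i})" "(None, i) \<in> set D" for D
  proof -
    have "e h * eval (diag_word h D) = e h * (eval (diag_word h D) * e i)"
      using diag_zero[OF assms(1) sub[OF D(1)] D(2)] by simp
    also have "\<dots> = e h * e i * eval (diag_word h D)"
      using diag_e_comm[OF assms(1) sub[OF D(1)], of i] assms(2) by (simp add: mult.assoc)
    finally show ?thesis using column_zero[OF assms(1,2) D(1)] by simp
  qed
  have lift: "diag_word h D = map (\<lambda>x. G x i h) (letters_at i D)"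
    if "D \<in> lists (entries XM {i})" "(None, i) \<notin> set D" for D
    using that
  proof (induction D)
    case (Cons d D)
    then show ?case by (cases d) auto
  qed simp
  have paths: "path (diag_word h D) i =
      (if (None, i) \<in> set D then None else Some (\<phi>M (letters_at i D), i))"
    if "D \<in> lists (entries XM {i})" for D
    using path_diag[OF that, of i h] assms(2) by simp
  show ?thesis
  proof (cases "(None, i) \<in> set D")
    case True
    then show ?thesis using zero assms(3-5) paths by (auto split: if_splits)
  next
    case False
    then have False': "(None, i) \<notin> set D'" and
      eq: "\<phi>M (letters_at i D) = \<phi>M (letters_at i D')"
      using assms(3-5) paths by (auto split: if_splits)
    have "(letters_at i D, letters_at i D') \<in> generated_congruence (free_monoid XM) RM"
      using \<phi>M_kernel[OF letters_at_lists[OF assms(3) False] letters_at_lists[OF assms(4) False']]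
        eq by simp
    then show ?thesis
      using lift_congruence[OF assms(1,2)] lift[OF assms(3) False] lift[OF assms(4) False'] by simp
  qed
qed

text \<open>Induction on the set of indices, splitting off the letters of one index at a time.\<close>

lemma diag_eq:
  assumes "h \<in> N" "finite A" "A \<subseteq> P h"
    "D \<in> lists (entries XM A)" "D' \<in> lists (entries XM A)"
    "\<And>i. i \<in> A \<Longrightarrow> path (diag_word h D) i = path (diag_word h D') i"
  shows "e h * eval (diag_word h D) = e h * eval (diag_word h D')"
  using assms(2-6)
proof (induction A arbitrary: D D' rule: finite_induct)
  case empty
  then have "D = []" "D' = []" by (simp_all add: entries_def)
  then show ?case by simp
next
  case (insert i A)
  let ?C = "filter (\<lambda>d. snd d = i)" and ?R = "filter (\<lambda>d. snd d \<noteq> i)"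
  have i: "i \<in> P h" using insert.prems(1) by simp
  have sub: "D \<in> lists (entries XM (P h))" if "D \<in> lists (entries XM (insert i A))" for D
    using entries_lists_mono[OF that insert.prems(1)] .
  have cols: "?C D \<in> lists (entries XM {i})" "?R D \<in> lists (entries XM A)"
    if "D \<in> lists (entries XM (insert i A))" for D
    using filter_entries[OF that, of "\<lambda>j. j = i" "{i}"]
      filter_entries[OF that, of "\<lambda>j. j \<noteq> i" A] by blast+
  have C: "path (diag_word h (?C D)) i = path (diag_word h D) i"
    if "D \<in> lists (entries XM (insert i A))" for D
    using path_diag[OF that, of i h] path_diag[OF cols(1)[OF that], of i h] i
    by (simp add: letters_at_filter)
  have R: "path (diag_word h (?R D)) j = path (diag_word h D) j"
    if "D \<in> lists (entries XM (insert i A))" "j \<in> A" for D j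
  proof -
    have "j \<noteq> h" "j \<noteq> i" using that insert by auto
    then show ?thesis
      using path_diag[OF that(1), of j h] path_diag[OF cols(2)[OF that(1)], of j h]
      by (simp add: letters_at_filter)
  qed
  have eC: "e h * eval (diag_word h (?C D)) = e h * eval (diag_word h (?C D'))"
    by (rule column_eq[OF assms(1) i cols(1) cols(1)])
      (simp_all only: insert.prems C insertI1)
  have eR: "e h * eval (diag_word h (?R D)) = e h * eval (diag_word h (?R D'))"
    by (rule insert.IH[OF _ cols(2) cols(2)])
      (use insert.prems in \<open>simp_all only: R insertI2 insert_subset\<close>)
  have comm: "e h * eval (diag_word h (?C D')) = eval (diag_word h (?C D')) * e h"
    using diag_e_comm[OF assms(1) entries_lists_mono[OF cols(1)[OF insert.prems(3)]] assms(1)] i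
    by simp
  have "e h * eval (diag_word h D) =
      e h * eval (diag_word h (?C D)) * eval (diag_word h (?R D))"
    using diag_split[OF assms(1) sub[OF insert.prems(2)], of i] by (simp add: mult.assoc)
  also have "\<dots> = eval (diag_word h (?C D')) * (e h * eval (diag_word h (?R D)))"
    using eC comm by (simp add: mult.assoc)
  also have "\<dots> = e h * eval (diag_word h (?C D')) * eval (diag_word h (?R D'))"
    using eR comm by (simp add: mult.assoc)
  finally show ?case
    using diag_split[OF assms(1) sub[OF insert.prems(3)], of i] by (simp add: mult.assoc)
qed

end

section \<open>Products of swaps\<close>

text \<open>The point at which a letter is undefined; \<open>hole_out\<close> is the point missing from its image.\<close>

primrec hole_in :: "'x letter \<Rightarrow> nat" where
  "hole_in (F i j) = i" | "hole_in (E i) = i" | "hole_in (G x i j) = j"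

primrec hole_out :: "'x letter \<Rightarrow> nat" where
  "hole_out (F i j) = j" | "hole_out (E i) = i" | "hole_out (G x i j) = j"

context faithful_relations
begin

text \<open>The step in the usual proof that the conjugation rules of the transpositions present the symmetric
  group: swaps involving \<open>d\<close> are moved to the right, where any two of them merge into at most one.\<close>

lemma swaps_collect:
  assumes "h \<in> N" "Q \<subseteq> P h" "d \<in> Q" "ts \<in> lists (pairs Q)"
  shows "\<exists>ts' \<in> lists (pairs (Q - {d})).
    e h * eval (swap_word h ts) = e h * eval (swap_word h ts') \<or>
    (\<exists>i \<in> Q - {d}. e h * eval (swap_word h ts) = e h * eval (swap_word h ts') * swap h d i)"
  using assms(4)
proof (induction ts rule: rev_induct)
  case Nil
  show ?case by (intro bexI[of _ "[]"]) auto
next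
  case (snoc t ts)
  have *: ?case if kl: "eval (swap_word h [t]) = swap h k l" "k \<in> Q" "l \<in> Q" "k \<noteq> l" "l \<noteq> d" for k l
  proof -
    have last: "e h * eval (swap_word h (ts @ [t])) = e h * eval (swap_word h ts) * swap h k l"
      using kl(1) by (simp add: mult.assoc)
    have append: "e h * eval (swap_word h (ts' @ [(a, b)])) = e h * eval (swap_word h ts') * swap h a b"
      for ts' a b by (simp add: swap_def mult.assoc)
    have inN: "\<And>i. i \<in> Q \<Longrightarrow> i \<in> N \<and> i \<noteq> h" using assms(2) by auto
    obtain ts' where ts': "ts' \<in> lists (pairs (Q - {d}))" and
      alt: "e h * eval (swap_word h ts) = e h * eval (swap_word h ts') \<or>
      (\<exists>i \<in> Q - {d}. e h * eval (swap_word h ts) = e h * eval (swap_word h ts') * swap h d i)"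
      using snoc by auto
    have ts'P: "ts' \<in> lists (pairs (P h))"
      using ts' lists_mono[of "pairs (Q - {d})" "pairs (P h)"] inN by (auto simp: pairs_def)
    show ?thesis
    proof (cases "e h * eval (swap_word h ts) = e h * eval (swap_word h ts')")
      case True
      show ?thesis
      proof (cases "k = d")
        case True
        then show ?thesis
          using last \<open>e h * eval (swap_word h ts) = e h * eval (swap_word h ts')\<close> kl ts'
          by (intro bexI[of _ ts']) auto
      next
        case False
        then show ?thesis
          using last \<open>e h * eval (swap_word h ts) = e h * eval (swap_word h ts')\<close> kl ts' append
          by (intro bexI[of _ "ts' @ [(k, l)]"]) auto
      qed
    next
      case False
      then obtain i where i: "i \<in> Q - {d}" and
        eq: "e h * eval (swap_word h ts) = e h * eval (swap_word h ts') * swap h d i"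
        using alt by blast
      have last': "e h * eval (swap_word h (ts @ [t])) =
          e h * eval (swap_word h ts') * (swap h d i * swap h k l)"
        using last eq by (simp add: mult.assoc)
      \<comment> \<open>Two swaps of \<open>d\<close> cancel if they agree and otherwise leave one behind a swap avoiding \<open>d\<close>.\<close>
      consider "k = d" "l = i" | "k = d" "l \<noteq> i" | "k \<noteq> d" by blast
      then show ?thesis
      proof cases
        case 1
        then have "e h * eval (swap_word h (ts @ [t])) = e h * (eval (swap_word h ts') * e h)"
          using last' swap_swap[of h d i] inN[of d] inN[of i] i assms(1,3) by (simp add: mult.assoc)
        also have "\<dots> = e h * eval (swap_word h ts')"
          unfolding swaps_e_comm[OF assms(1) ts'P] using assms(1) by (simp add: e_idem flip: mult.assoc)
        finally show ?thesis using ts' by blast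
      next
        case 2
        then have "swap h d i * swap h d l = swap h i l * swap h d i"
          using swap_swap_conj[of h d i d l] inN[of d] inN[of i] inN[of l] i kl assms(1,3) by simp
        then have "e h * eval (swap_word h (ts @ [t])) =
            e h * eval (swap_word h (ts' @ [(i, l)])) * swap h d i"
          unfolding append using last' 2 by (simp add: mult.assoc)
        then show ?thesis
          using i ts' 2 kl by (intro bexI[of _ "ts' @ [(i, l)]"]) auto
      next
        \<comment> \<open>Moving the pair \<open>(k, l)\<close> to the left across the swap of \<open>d\<close> would rename it to a pair containing
            \<open>d\<close> if \<open>i\<close> occurs in it; hence the swap of \<open>d\<close> is renamed instead.\<close>
        case 3
        let ?i = "transpose k l i"
        have i': "?i \<in> Q - {d}" using i kl 3 by (auto simp: transpose_def)
        have "swap h d i * swap h k l = swap h k l * swap h d ?i"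
          using swap_swap_conj[of h k l d ?i] inN[of d] inN[of ?i] inN[of k] inN[of l] i' kl 3 assms(1,3)
          by simp
        then have "e h * eval (swap_word h (ts @ [t])) =
            e h * eval (swap_word h (ts' @ [(k, l)])) * swap h d ?i"
          unfolding append using last' by (simp add: mult.assoc)
        then show ?thesis
          using i' ts' 3 kl by (intro bexI[of _ "ts' @ [(k, l)]"]) auto
      qed
    qed
  qed
  obtain k l where t: "t = (k, l)" by fastforce
  have kl: "k \<in> Q" "l \<in> Q" "k \<noteq> l" using snoc.prems t by auto
  have s: "eval (swap_word h [t]) = swap h k l" using t by (simp add: swap_def mult.assoc)
  show ?case
  proof (cases "l = d")
    case False
    then show ?thesis using * s kl by blast
  next
    case True
    have "swap h k l = swap h l k" using swap_commute[of h k l] kl assms(1,2) by auto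
    then show ?thesis using *[of l k] s kl True by simp
  qed
qed

text \<open>Soundness replaces the computation of the permutations on both sides of a rewriting step.\<close>

lemma perm_cong:
  assumes "h \<in> N" "ts \<in> lists (pairs (P h))" "ts' \<in> lists (pairs (P h))"
    "e h * eval (swap_word h ts) = e h * eval (swap_word h ts')" "p \<noteq> h"
  shows "perm ts p = perm ts' p"
proof -
  have "path (E h # diag_word h [] @ swap_word h ts) = path (E h # diag_word h [] @ swap_word h ts')"
    by (rule sound) (use assms swap_word_letters in auto)
  from fun_cong[OF this, of p] show ?thesis
    using path_normal[OF assms(1) _ assms(2), of "[]" p]
      path_normal[OF assms(1) _ assms(3), of "[]" p] assms(5) by simp
qed

text \<open>Here \<open>z\<close> is an element for which the places in \<open>A\<close> are empty. The points in \<open>B\<close> are eliminated one by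
  one: after collecting, a remaining swap of \<open>d\<close> would move \<open>d\<close>, so there is none. Swaps within \<open>A\<close>
  are absorbed directly.\<close>

lemma swaps_absorbed:
  assumes "h \<in> N" "finite B" "A \<inter> B = {}" "A \<union> B \<subseteq> P h" "ts \<in> lists (pairs (A \<union> B))"
    and fixed: "\<And>i. i \<in> B \<Longrightarrow> perm ts i = i"
    and z: "z * e h = z" "\<And>i. i \<in> A \<Longrightarrow> z * e i = z"
  shows "z * eval (swap_word h ts) = z"
  using assms(2-6)
proof (induction B arbitrary: ts rule: finite_induct)
  case empty
  have "z * swap h i j = z" if "(i, j) \<in> pairs A" for i j
  proof -
    have ij: "i \<in> A" "j \<in> A" "i \<noteq> j" "i \<in> P h" "j \<in> P h" using that empty by auto
    have "z * swap h i j = z * e h * e i * e j * swap h i j" using z ij by simp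
    also have "\<dots> = z * (e h * e i * e j * swap h i j)" by (simp add: mult.assoc)
    also have "\<dots> = z * e h * e i * e j"
      using swap_absorbed[of h i j] ij assms(1) by (simp add: mult.assoc)
    finally show ?thesis using z ij by simp
  qed
  moreover have "ts \<in> lists (pairs A)" using empty by simp
  ultimately show ?case
  proof (induction ts)
    case (Cons t ts)
    obtain i j where t: "t = (i, j)" by fastforce
    then have "z * eval (swap_word h (t # ts)) = z * swap h i j * eval (swap_word h ts)"
      unfolding t swap_as_eval by (simp add: mult.assoc)
    then show ?case using Cons t by simp
  qed simp
next
  case (insert d B)
  have Q: "A \<union> insert d B \<subseteq> P h" "d \<in> A \<union> insert d B" "A \<union> insert d B - {d} = A \<union> B"
    using insert.prems insert.hyps by auto
  obtain ts' where ts': "ts' \<in> lists (pairs (A \<union> B))" and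
    alt: "e h * eval (swap_word h ts) = e h * eval (swap_word h ts') \<or>
      (\<exists>i \<in> A \<union> B. e h * eval (swap_word h ts) = e h * eval (swap_word h ts') * swap h d i)"
    using swaps_collect[OF assms(1) Q(1,2) insert.prems(3)] unfolding Q(3) by blast
  have mono: "us \<in> lists (pairs (P h))" if "us \<in> lists (pairs R)" "R \<subseteq> P h" for us R
    using that lists_mono[of "pairs R" "pairs (P h)"] by (auto simp: pairs_def)
  have tsP: "ts \<in> lists (pairs (P h))" "ts' \<in> lists (pairs (P h))"
    using mono[OF insert.prems(3)] mono[OF ts'] insert.prems(2) by auto
  have same: "e h * eval (swap_word h ts) = e h * eval (swap_word h ts')"
  proof (rule ccontr)
    assume "\<not> ?thesis"
    then obtain i where i: "i \<in> A \<union> B" and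
      "e h * eval (swap_word h ts) = e h * eval (swap_word h ts') * swap h d i"
      using alt by blast
    then have "e h * eval (swap_word h ts) = e h * eval (swap_word h (ts' @ [(d, i)]))"
      by (simp add: swap_def mult.assoc)
    moreover have di: "i \<noteq> d" "d \<noteq> h" "d \<notin> A \<union> B" "(d, i) \<in> pairs (P h)"
      using i insert.prems insert.hyps by auto
    moreover have "ts' @ [(d, i)] \<in> lists (pairs (P h))" using tsP(2) di(4) by simp
    ultimately have "perm ts d = perm (ts' @ [(d, i)]) d"
      using perm_cong[OF assms(1) tsP(1)] by blast
    then show False
      using insert.prems(4)[of d] perm_fixes[OF ts' di(3)] di(1) by simp
  qed
  have "z * eval (swap_word h ts) = z * (e h * eval (swap_word h ts))"
    using z(1) by (simp flip: mult.assoc)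
  also have "\<dots> = z * eval (swap_word h ts')"
    unfolding same using z(1) by (simp flip: mult.assoc)
  also have "\<dots> = z"
  proof (rule insert.IH)
    fix i assume "i \<in> B"
    then have "i \<noteq> h" using insert.prems by auto
    then show "perm ts' i = i"
      using perm_cong[OF assms(1) tsP same, of i] insert.prems(4)[of i] \<open>i \<in> B\<close> by simp
  qed (use insert.prems ts' in auto)
  finally show ?case .
qed

lemma swaps_rev:
  assumes "h \<in> N" "ts \<in> lists (pairs (P h))"
  shows "eval (swap_word h (rev ts)) * eval (swap_word h ts) * e h = e h"
  using assms(2)
proof (induction ts)
  case (Cons t ts)
  obtain i j where t: "t = (i, j)" by fastforce
  then have ij: "i \<in> N" "j \<in> N" "distinct [h, i, j]" using Cons.hyps(1) by auto
  have "eval (swap_word h (rev (t # ts))) * eval (swap_word h (t # ts)) * e h =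
      eval (swap_word h (rev ts)) * (swap h i j * swap h i j) * (eval (swap_word h ts) * e h)"
    unfolding t swap_as_eval by (simp add: swap_def mult.assoc)
  also have "\<dots> = eval (swap_word h (rev ts)) * e h * (e h * eval (swap_word h ts))"
    using swap_swap[OF assms(1) ij] swaps_e_comm[OF assms(1) Cons.hyps(2)] by simp
  also have "\<dots> = eval (swap_word h (rev ts)) * (eval (swap_word h ts) * e h)"
    using swaps_e_comm[OF assms(1) Cons.hyps(2)] e_idem[OF assms(1), THEN mult_ctx]
    by (simp add: mult.assoc)
  finally show ?case using Cons.IH by (simp add: mult.assoc)
qed simp

end

section \<open>Words with equal paths\<close>

context faithful_relations
begin

text \<open>The diagonal parts agree by \<open>diag_eq\<close>. The permutations agree on all places that the diagonal part
  keeps, so it absorbs the first product of swaps times the inverse of the second.\<close>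

lemma normal_unique:
  assumes "h \<in> N" "D \<in> lists (entries XM (P h))" "ts \<in> lists (pairs (P h))"
    "D' \<in> lists (entries XM (P h))" "ts' \<in> lists (pairs (P h))"
    "path (E h # diag_word h D @ swap_word h ts) = path (E h # diag_word h D' @ swap_word h ts')"
  shows "e h * eval (diag_word h D) * eval (swap_word h ts) =
    e h * eval (diag_word h D') * eval (swap_word h ts')"
proof -
  have paths: "(if (None, p) \<in> set D then None else Some (\<phi>M (letters_at p D), perm ts p)) =
      (if (None, p) \<in> set D' then None else Some (\<phi>M (letters_at p D'), perm ts' p))"
    if "p \<noteq> h" for p
    using fun_cong[OF assms(6), of p] path_normal[of h] assms(1-5) that by simp
  have "finite (P h)" by (simp add: N_def)
  moreover have "path (diag_word h D) p = path (diag_word h D') p" if "p \<in> P h" for p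
    using paths[of p] path_diag[OF assms(2), of p h] path_diag[OF assms(4), of p h] that
    by (auto split: if_splits)
  ultimately have diag: "e h * eval (diag_word h D) = e h * eval (diag_word h D')"
    by (rule diag_eq[OF assms(1) _ subset_refl assms(2,4)])
  define z where "z = e h * eval (diag_word h D)"
  define A where "A = {i \<in> P h. (None, i) \<in> set D}"
  have z: "z * e h = z" "i \<in> A \<Longrightarrow> z * e i = z" for i
    using diag_e_comm[OF assms(1,2,1)] e_idem[OF assms(1), THEN mult_ctx] diag_zero[OF assms(1,2)]
    by (simp_all add: z_def A_def mult.assoc)
  have absorb: "z * eval (swap_word h (ts @ rev ts')) = z"
  proof (rule swaps_absorbed[OF assms(1), of "P h - A" A])
    have "A \<union> (P h - A) = P h" by (auto simp: A_def)
    then show "ts @ rev ts' \<in> lists (pairs (A \<union> (P h - A)))"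
      using assms(3,5) by (simp add: in_lists_conv_set ball_Un)
    fix i assume "i \<in> P h - A"
    then have "perm ts i = perm ts' i" using paths[of i] by (auto simp: A_def split: if_splits)
    then show "perm (ts @ rev ts') i = i" by (simp add: perm_rev)
  qed (use z in \<open>auto simp: A_def N_def\<close>)
  have zts: "z * eval (swap_word h ts) = z * eval (swap_word h ts) * e h"
    using swaps_e_comm[OF assms(1,3)] z(1) by (metis mult.assoc)
  have "\<dots> = z * eval (swap_word h (ts @ rev ts')) * (eval (swap_word h ts') * e h)"
    using swaps_rev[OF assms(1,5)] by (simp add: mult.assoc)
  also have "\<dots> = z * (e h * eval (swap_word h ts'))"
    unfolding absorb swaps_e_comm[OF assms(1,5)] ..
  also have "\<dots> = z * eval (swap_word h ts')"
    using z(1) by (simp flip: mult.assoc)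
  finally show ?thesis using zts diag unfolding z_def by simp
qed

lemma corner_unique:
  assumes "h \<in> N" "u \<in> words" "v \<in> words" "path u = path v"
    "e h * eval u * e h = eval u" "e h * eval v * e h = eval v"
  shows "eval u = eval v"
proof -
  have normal: "\<exists>D ts. D \<in> lists (entries XM (P h)) \<and> ts \<in> lists (pairs (P h)) \<and>
      eval w = e h * eval (diag_word h D) * eval (swap_word h ts) \<and>
      path w = path (E h # diag_word h D @ swap_word h ts)"
    if w: "w \<in> words" "e h * eval w * e h = eval w" for w
  proof -
    obtain D ts where D: "D \<in> lists (entries XM (P h))" "ts \<in> lists (pairs (P h))"
      "eval w = e h * eval (diag_word h D) * eval (swap_word h ts)"
      using word_in_corner[OF assms(1) w(1)] w(2) unfolding corner_def by auto
    then have "path w = path (E h # diag_word h D @ swap_word h ts)"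
      using assms(1) w(1) diag_word_letters swap_word_letters
      by (intro sound) (auto simp: mult.assoc)
    then show ?thesis using D by blast
  qed
  show ?thesis
    using normal[OF assms(2,5)] normal[OF assms(3,6)] normal_unique[OF assms(1)] assms(4) by metis
qed

lemma hole_in: "a \<in> alphabet n XM \<Longrightarrow> hole_in a \<in> N \<and> step a (hole_in a) = None"
  by (cases a) auto

lemma hole_out:
  assumes "a \<in> alphabet n XM"
  shows "hole_out a \<in> N" "step a p = Some (m, q) \<Longrightarrow> q \<noteq> hole_out a"
  using assms by (cases a; auto split: if_splits)+

text \<open>The hole \<open>h\<close> before the first letter and the hole \<open>k\<close> behind the last letter of \<open>u\<close> can be seen in
  the path, so they are holes of \<open>v\<close> as well. Appending the move of the hole from \<open>k\<close> to \<open>h\<close> brings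
  both words into the corner at \<open>h\<close>, and this can be undone.\<close>

theorem path_determines_eval:
  assumes "u \<in> words" "v \<in> words" "u \<noteq> []" "path u = path v"
  shows "eval u = eval v"
proof -
  obtain h where h: "h \<in> N" "path u h = None"
  proof -
    obtain a w where "u = a # w" "a \<in> alphabet n XM"
      using assms(1,3) by (cases u) auto
    then show thesis using hole_in[of a] that[of "hole_in a"] by (simp add: seq_None)
  qed
  obtain k where k: "k \<in> N" "\<And>p m. path u p \<noteq> Some (m, k)"
  proof -
    obtain w a where w: "u = w @ [a]" "w \<in> words" "a \<in> alphabet n XM"
      using assms(1,3) by (cases u rule: rev_cases) auto
    have u: "path u = seq (path w) (step a)"
      using path_append[of w n "[a]"] path_letter[of a n] w by simp
    have "path u p \<noteq> Some (m, hole_out a)" for p m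
      using hole_out(2)[OF w(3)] unfolding u by (auto simp: seq_def split: option.split)
    then show thesis using that[of "hole_out a"] hole_out(1)[OF w(3)] by blast
  qed
  have hop: "hop k h \<in> words" using h(1) k(1) by (simp add: hop_def)
  have round_trip: "eval (hop k h) * eval (hop h k) = e k" and fin_h: "eval (hop k h) * e h = eval (hop k h)"
    using h(1) k(1) by (auto simp: hop_def e_idem f_f_back f_e)
  have ends: "e h * eval w = eval w" "eval w * e k = eval w" if "w \<in> words" "path w = path u" for w
    using e_word[OF that(1) h(1)] word_e[OF that(1) k(1)] h(2) k(2) that(2) by simp_all
  have corner: "e h * eval (w @ hop k h) * e h = eval (w @ hop k h)"
    if "w \<in> words" "path w = path u" for w
    using ends(1)[OF that] fin_h by (simp add: mult.assoc) (simp flip: mult.assoc)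
  have "path (u @ hop k h) = path (v @ hop k h)"
    using path_append[OF assms(1) hop] path_append[OF assms(2) hop] assms(4) by simp
  then have "eval (u @ hop k h) = eval (v @ hop k h)"
    using corner_unique[OF h(1), of "u @ hop k h" "v @ hop k h"] corner assms hop by simp
  then have "eval u * (eval (hop k h) * eval (hop h k)) = eval v * (eval (hop k h) * eval (hop h k))"
    by (simp flip: mult.assoc)
  then show ?thesis using round_trip ends(2) assms by simp
qed

end

section \<open>The universal model of a semigroup presentation\<close>

text \<open>Transformations of a set under composition, as a type of its own in order to be an instance of
  \<open>monoid_mult\<close>.\<close>

datatype 'a endo = Endo (app: "'a \<Rightarrow> 'a")

instantiation endo :: (type) monoid_mult
begin

definition "1 = Endo id"
definition "s * t = Endo (app s \<circ> app t)"

instance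
  by standard (simp_all add: one_endo_def times_endo_def comp_assoc)

end

lemma app_simps [simp]: "app 1 C = C" "app (s * t) C = app s (app t C)"
  by (simp_all add: one_endo_def times_endo_def)

locale semigroup_relations =
  fixes X :: "'a set" and R :: "('a list \<times> 'a list) set"
  assumes R_nonempty: "R \<subseteq> carrier (free_semigroup X) \<times> carrier (free_semigroup X)"
begin

abbreviation rel where "rel \<equiv> generated_congruence (free_semigroup X) R"

lemma rel_carrier:
  "(u, v) \<in> rel \<Longrightarrow> u \<in> lists X \<and> u \<noteq> [] \<and> v \<in> lists X \<and> v \<noteq> []"
proof (induction rule: generated_congruence.induct)
  case (base u v)
  then show ?case using R_nonempty by (auto simp: free_semigroup_def)
qed (auto simp: free_semigroup_def)

definition cls :: "'a list \<Rightarrow> 'a list set" where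
  "cls c = {d. d = c \<or> (c, d) \<in> rel}"

lemma cls_eq: "(c, d) \<in> rel \<Longrightarrow> cls c = cls d"
  unfolding cls_def
  by (blast intro: generated_congruence.sym generated_congruence.trans)

text \<open>The classes depend on \<open>X\<close> and \<open>R\<close>, so they do not form a type. Instead the letters act
  on arbitrary sets of words, by multiplication from the left followed by saturation; words outside
  \<open>lists X\<close>, which the congruence does not control, are discarded first.\<close>

definition left_mult :: "'a \<Rightarrow> 'a list set endo" where
  "left_mult a = Endo (\<lambda>C. \<Union>c \<in> C \<inter> lists X. cls (a # c))"

abbreviation act_word :: "'a list \<Rightarrow> 'a list set endo" where
  "act_word w \<equiv> prod_list (map left_mult w)"

lemma app_act_word:
  "w \<in> lists X \<Longrightarrow> w \<noteq> [] \<Longrightarrow> app (act_word w) C = (\<Union>c \<in> C \<inter> lists X. cls (w @ c))"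
proof (induction w)
  case (Cons a w)
  show ?case
  proof (cases "w = []")
    case True
    then show ?thesis by (simp add: left_mult_def)
  next
    case False
    have a: "[a] \<in> carrier (free_semigroup X)" using Cons.prems by (simp add: free_semigroup_def)
    have "cls (a # d) = cls (a # w @ c)" if "d \<in> cls (w @ c)" for c d
    proof (cases "d = w @ c")
      case False
      then have "(w @ c, d) \<in> rel" using that by (simp add: cls_def)
      from generated_congruence.left[OF this a] have "(a # w @ c, a # d) \<in> rel"
        by (simp add: free_semigroup_def)
      then show ?thesis using cls_eq by blast
    qed simp
    moreover have "w @ c \<in> cls (w @ c) \<inter> lists X" if "c \<in> lists X" for c
      using that Cons.prems by (simp add: cls_def)
    moreover have "app (act_word (a # w)) C =
        (\<Union>d \<in> (\<Union>c \<in> C \<inter> lists X. cls (w @ c)) \<inter> lists X. cls (a # d))"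
    proof -
      have IH: "app (act_word w) C = (\<Union>c \<in> C \<inter> lists X. cls (w @ c))"
        using Cons False by simp
      show ?thesis by (simp add: IH) (simp add: left_mult_def)
    qed
    ultimately show ?thesis by fastforce
  qed
qed simp

lemma act_word_relation:
  assumes "(u, v) \<in> R"
  shows "act_word u = act_word v"
proof -
  have uv: "(u, v) \<in> rel" using assms by (rule generated_congruence.base)
  have eq: "cls (u @ c) = cls (v @ c)" if "c \<in> lists X" for c
  proof (cases "c = []")
    case False
    then have "(u @ c, v @ c) \<in> rel"
      using generated_congruence.right[OF uv, of c] that by (simp add: free_semigroup_def)
    then show ?thesis by (rule cls_eq)
  qed (use cls_eq[OF uv] in simp)
  have "app (act_word u) = app (act_word v)"
    using eq rel_carrier[OF uv] by (intro ext) (simp add: app_act_word)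
  then show ?thesis by (rule endo.expand)
qed

text \<open>Applied to the set that contains only the empty word, a word returns its own class.\<close>

lemma act_word_faithful:
  assumes "u \<in> lists X" "v \<in> lists X" "act_word u = act_word v"
  shows "u = v \<or> (u, v) \<in> rel"
proof -
  have cls: "app (act_word w) {[]} = cls w" if "w \<in> lists X" for w
    using that app_act_word[of w "{[]}"] rel_carrier[of "[]"] by (cases "w = []") (auto simp: cls_def)
  have "cls u = cls v" using cls[OF assms(1)] cls[OF assms(2)] assms(3) by simp
  moreover have "v \<in> cls v" by (simp add: cls_def)
  ultimately have "v \<in> cls u" by simp
  then show ?thesis by (auto simp: cls_def)
qed

end

section \<open>Soundness of the relations\<close>

lemma relations_nonempty:
  "relations n XM RM \<subseteq>
    carrier (free_semigroup (alphabet n XM)) \<times> carrier (free_semigroup (alphabet n XM))"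
proof -
  have "u \<noteq> [] \<and> v \<noteq> []" if "(u, v) \<in> relations_A \<union> relations_B RM \<union> relations_C" for u v
  proof -
    have "(u, v) \<in> relations_B RM \<Longrightarrow> u \<noteq> [] \<and> v \<noteq> []"
      by (induction rule: relations_B.induct) (auto simp: lift_word_def)
    then show ?thesis using that by (auto elim: relations_A.cases relations_C.cases)
  qed
  then show ?thesis by (fastforce simp: relations_def free_semigroup_def)
qed

context presented_monoid
begin

text \<open>The points on which the two sides could differ are the indices of the relation.\<close>

lemma path_relations_A:
  assumes "(u, v) \<in> relations_A"
  shows "path u p = path v p"
  using assms
proof cases
  case (A1 i j)
  then show ?thesis by (cases "p = i"; cases "p = j") (simp_all add: seq_def)
next
  case (A2a i j)
  then show ?thesis by (cases "p = i"; cases "p = j") (simp_all add: seq_def)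
next
  case (A2b i j)
  then show ?thesis by (cases "p = i"; cases "p = j") (simp_all add: seq_def)
next
  case (A3 i j k l)
  then show ?thesis
    by (cases "p = i"; cases "p = j"; cases "p = k"; cases "p = l")
      (simp_all add: seq_def)
next
  case (A4 i j k)
  then show ?thesis
    by (cases "p = i"; cases "p = j"; cases "p = k") (simp_all add: seq_def)
next
  case (A5a i j k)
  then show ?thesis
    by (cases "p = i"; cases "p = j"; cases "p = k") (simp_all add: seq_def)
next
  case (A5b i j k)
  then show ?thesis
    by (cases "p = i"; cases "p = j"; cases "p = k") (simp_all add: seq_def)
next
  case (A6 i j k)
  then show ?thesis
    by (cases "p = i"; cases "p = j"; cases "p = k") (simp_all add: seq_def)
next
  case (A7 i j k l)
  then show ?thesis
    by (cases "p = i"; cases "p = j"; cases "p = k"; cases "p = l")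
      (simp_all add: seq_def)
qed

lemma path_lift_word:
  assumes "u \<in> lists XM" "i \<noteq> j"
  shows "path (lift_word i j u) p = (if p = j then None else Some (if p = i then \<phi>M u else \<one>, p))"
proof -
  have "path (map (\<lambda>x. G x i j) u) p = (if p = j \<and> u \<noteq> [] then None
      else Some (if p = i then \<phi>M u else \<one>, p))"
    using assms(1)
  proof (induction u)
    case (Cons x u)
    then show ?case
      using assms(2) \<phi>M_Cons[of x u] by (auto simp: seq_def)
  qed (simp add: \<phi>M_Nil)
  then show ?thesis by (cases "u = []") (auto simp: lift_word_def seq_def \<phi>M_Nil)
qed

lemma path_relations_B:
  assumes "(u, v) \<in> relations_B RM" "set u \<subseteq> alphabet n XM" "set v \<subseteq> alphabet n XM"
  shows "path u = path v"
  using assms(1)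
proof cases
  case (B3 u' v' i j)
  then have uv: "u' \<in> lists XM" "v' \<in> lists XM" using RM_in_lists by auto
  moreover have "\<phi>M u' = \<phi>M v'"
    using \<phi>M_kernel[OF uv] generated_congruence.base[OF B3(3)] by blast
  ultimately show ?thesis using B3 path_lift_word by (intro ext) simp
qed (use assms(2,3) \<phi>M_closed in \<open>auto simp: seq_def alphabet_def fun_eq_iff\<close>)

lemma path_relations_C:
  assumes "(u, v) \<in> relations_C" "set u \<subseteq> alphabet n XM" "set v \<subseteq> alphabet n XM"
  shows "path u = path v"
  using assms(1)
  by cases (use assms(2,3) \<phi>M_closed in \<open>auto simp: seq_def alphabet_def fun_eq_iff\<close>)

lemma path_congruence:
  assumes "(u, v) \<in> generated_congruence (free_semigroup (alphabet n XM)) (relations n XM RM)"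
  shows "path u = path v"
proof -
  interpret semigroup_relations "alphabet n XM" "relations n XM RM"
    by standard (rule relations_nonempty)
  show ?thesis using assms
  proof induction
    case (base u v)
    then show ?case
      using path_relations_A[of u v] path_relations_B path_relations_C
      by (auto simp: relations_def fun_eq_iff)
  next
    case (left u v w)
    then show ?case
      using rel_carrier[OF left.hyps(1)] path_append[of w n] by (simp add: free_semigroup_def)
  next
    case (right u v w)
    then show ?case
      using rel_carrier[OF right.hyps(1)] path_append[of _ n w] by (simp add: free_semigroup_def)
  qed auto
qed

end

sublocale presented_monoid \<subseteq> universal: semigroup_relations "alphabet n XM" "relations n XM RM" for n
  by standard (rule relations_nonempty)

context presented_monoid
begin

text \<open>Equal actions mean congruent words, and congruent words have equal paths by soundness.\<close>

lemma universal_faithful: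
  "faithful_relations M XM RM \<phi>M n (semigroup_relations.left_mult (alphabet n XM) (relations n XM RM))"
proof -
  interpret W: wreath_relations n XM RM "universal.left_mult n"
    by standard (use RM_in_lists universal.act_word_relation in auto)
  show ?thesis
  proof
    fix u v
    assume "u \<in> lists (alphabet n XM)" "v \<in> lists (alphabet n XM)" "W.eval u = W.eval v"
    then show "path u = path v"
      using universal.act_word_faithful[of u n v] path_congruence by (auto simp: W.eval_def)
  qed
qed

end

section \<open>Paths as elements of the wreath product\<close>

text \<open>The complements of the domain and of the image are equinumerous.\<close>

lemma injection_extends_to_permutation:
  assumes "finite S" "B \<subseteq> S" "inj_on \<beta> B" "\<beta> ` B \<subseteq> S"
  shows "\<exists>\<pi>. \<pi> permutes S \<and> (\<forall>x \<in> B. \<pi> x = \<beta> x)"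
proof -
  have "card (S - B) = card (S - \<beta> ` B)"
    using assms by (simp add: card_Diff_subset card_image finite_subset)
  then obtain \<gamma> where \<gamma>: "bij_betw \<gamma> (S - B) (S - \<beta> ` B)"
    using assms(1) finite_same_card_bij by blast
  define \<pi> where "\<pi> x = (if x \<in> B then \<beta> x else if x \<in> S then \<gamma> x else x)" for x
  have "bij_betw \<pi> B (\<beta> ` B)"
    using assms(3) by (auto simp: bij_betw_def inj_on_def \<pi>_def)
  moreover have "bij_betw \<pi> (S - B) (S - \<beta> ` B)"
    using \<gamma> by (rule bij_betw_cong[THEN iffD1, rotated]) (simp add: \<pi>_def)
  ultimately have "bij_betw \<pi> (B \<union> (S - B)) (\<beta> ` B \<union> (S - \<beta> ` B))"
    by (rule bij_betw_combine) auto
  then have "bij_betw \<pi> S S"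
    using assms(2,4) by (simp add: Un_absorb1)
  then have "\<pi> permutes S"
    using assms(2) by (intro bij_imp_permutes) (auto simp: \<pi>_def)
  then show ?thesis by (auto simp: \<pi>_def)
qed

lemma permutation_is_perm:
  assumes "\<pi> permutes A" "finite A"
  shows "\<exists>ts \<in> lists (pairs A). perm ts = \<pi>"
  using assms
proof (induction rule: permutes_induct)
  case id
  show ?case by (rule bexI[of _ "[]"]) auto
next
  case (swap a b p)
  then obtain ts where "ts \<in> lists (pairs A)" "perm ts = p" by blast
  then show ?case
    using swap.hyps by (intro bexI[of _ "ts @ [(a, b)]"]) auto
qed

context presented_monoid
begin

lemma diag_exists:
  assumes "finite A" "\<And>p m. p \<in> A \<Longrightarrow> a p = Some m \<Longrightarrow> m \<in> carrier M"
  shows "\<exists>D \<in> lists (entries XM A). \<forall>p \<in> A.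
    (if (None, p) \<in> set D then None else Some (\<phi>M (letters_at p D))) = a p"
  using assms
proof (induction A rule: finite_induct)
  case empty
  show ?case by (rule bexI[of _ "[]"]) auto
next
  case (insert q A)
  have "\<exists>D \<in> lists (entries XM A). \<forall>p \<in> A.
      (if (None, p) \<in> set D then None else Some (\<phi>M (letters_at p D))) = a p"
    by (rule insert.IH) (use insert.prems in blast)
  then obtain D where D: "D \<in> lists (entries XM A)"
    "\<And>p. p \<in> A \<Longrightarrow> (if (None, p) \<in> set D then None else Some (\<phi>M (letters_at p D))) = a p"
    by blast
  have D': "D \<in> lists (entries XM (insert q A))" using D(1) by (rule entries_lists_mono) auto
  have q: "letters_at q D = []" "(None, q) \<notin> set D"
    using D(1) insert.hyps(2)
  proof (induction D)
    case (Cons d D)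
    {
      case 1
      then show ?case using Cons by (cases d) auto
    next
      case 2
      then show ?case using Cons by (cases d) auto
    }
  qed simp_all
  show ?case
  proof (cases "a q")
    case None
    show ?thesis
    proof (intro bexI[of _ "(None, q) # D"] ballI)
      fix p assume "p \<in> insert q A"
      then show "(if (None, p) \<in> set ((None, q) # D) then None
          else Some (\<phi>M (letters_at p ((None, q) # D)))) = a p"
        using D(2)[of p] None by (cases "p = q") auto
    qed (use D' in simp)
  next
    case (Some m)
    obtain u where u: "u \<in> lists XM" "\<phi>M u = m" using insert.prems[of q m] Some \<phi>M_surj by auto
    define C where "C = map (\<lambda>x. (Some x, q)) u"
    have C: "C \<in> lists (entries XM (insert q A))" "\<And>p. (None, p) \<notin> set C"
      "letters_at q C = u" "\<And>p. p \<noteq> q \<Longrightarrow> letters_at p C = []"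
      using u(1) unfolding C_def by (induction u) auto
    have app: "letters_at p (C @ D) = letters_at p C @ letters_at p D" for p
      by (simp add: letters_at_def)
    show ?thesis
    proof (intro bexI[of _ "C @ D"] ballI)
      fix p assume "p \<in> insert q A"
      then show "(if (None, p) \<in> set (C @ D) then None else Some (\<phi>M (letters_at p (C @ D)))) = a p"
        using D(2)[of p] q C(2-4) u(2) Some app by (cases "p = q") auto
    qed (use C(1) D' in simp)
  qed
qed

text \<open>The element \<open>(a, \<alpha>)\<close> of the wreath product in which weights and targets are separated.\<close>

definition encode :: "nat \<Rightarrow> (nat \<Rightarrow> ('a \<times> nat) option)
    \<Rightarrow> (nat \<Rightarrow> 'a option) \<times> (nat \<rightharpoonup> nat)" where
  "encode n s = ((\<lambda>p\<in>{1..n}. map_option fst (s p)),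
    (\<lambda>p. if p \<in> {1..n} then map_option snd (s p) else None))"

lemma letter_image_encode:
  assumes "a \<in> alphabet n XM"
  shows "letter_image M \<phi>M n a = encode n (step a)"
  using assms
  by (cases a) (auto simp: encode_def pid_def alphabet_def restrict_map_def fun_eq_iff)

lemma encode_mult:
  assumes "\<And>p m q. p \<in> {1..n} \<Longrightarrow> s p = Some (m, q) \<Longrightarrow> q \<in> {1..n}"
  shows "encode n s \<otimes>\<^bsub>sing_wreath M n\<^esub> encode n t = encode n (seq s t)"
proof -
  have fst: "(\<lambda>p\<in>{1..n}. map_option fst (s p)) \<otimes>\<^bsub>zero_power M n\<^esub>
      act n (\<lambda>p. if p \<in> {1..n} then map_option snd (s p) else None) (\<lambda>p\<in>{1..n}. map_option fst (t p))
    = (\<lambda>p\<in>{1..n}. map_option fst (seq s t p))"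
  proof
    fix p
    show "((\<lambda>p\<in>{1..n}. map_option fst (s p)) \<otimes>\<^bsub>zero_power M n\<^esub>
      act n (\<lambda>p. if p \<in> {1..n} then map_option snd (s p) else None)
        (\<lambda>p\<in>{1..n}. map_option fst (t p))) p = (\<lambda>p\<in>{1..n}. map_option fst (seq s t p)) p"
    proof (cases "p \<in> {1..n}")
      case False
      then show ?thesis by (auto simp: zero_power_def product_group_def)
    next
      case p: True
      show ?thesis
      proof (cases "s p")
        case None
        then show ?thesis
          using p by (simp add: zero_power_def product_group_def adjoin_zero_def act_def seq_None)
      next
        case (Some mq)
        obtain m q where mq: "s p = Some (m, q)" using Some by (cases mq) auto
        then have "q \<in> {1..n}" using assms p by blast
        then show ?thesis
          using p mq
          by (cases "t q") (auto simp: zero_power_def product_group_def adjoin_zero_def act_def seq_Some)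
      qed
    qed
  qed
  have snd: "(\<lambda>p. if p \<in> {1..n} then map_option snd (t p) else None) \<circ>\<^sub>m
      (\<lambda>p. if p \<in> {1..n} then map_option snd (s p) else None)
    = (\<lambda>p. if p \<in> {1..n} then map_option snd (seq s t p) else None)"
  proof
    fix p
    show "((\<lambda>p. if p \<in> {1..n} then map_option snd (t p) else None) \<circ>\<^sub>m
      (\<lambda>p. if p \<in> {1..n} then map_option snd (s p) else None)) p
      = (if p \<in> {1..n} then map_option snd (seq s t p) else None)"
    proof (cases "p \<in> {1..n} \<and> s p \<noteq> None")
      case True
      then obtain m q where mq: "p \<in> {1..n}" "s p = Some (m, q)" by auto
      then have "q \<in> {1..n}" using assms by blast
      then show ?thesis using mq by (cases "t q") (auto simp: map_comp_def seq_Some)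
    next
      case False
      then show ?thesis by (cases "s p") (auto simp: map_comp_def seq_None)
    qed
  qed
  show ?thesis using fst snd by (simp add: encode_def sing_wreath_def)
qed

lemma step_range:
  "a \<in> alphabet n XM \<Longrightarrow> p \<in> {1..n} \<Longrightarrow> step a p = Some (m, q) \<Longrightarrow> q \<in> {1..n}"
  by (cases a) (auto simp: alphabet_def split: if_splits)

lemma path_range:
  assumes "w \<in> lists (alphabet n XM)" "p \<in> {1..n}" "path w p = Some (m, q)"
  shows "q \<in> {1..n}"
  using assms
proof (induction w arbitrary: p m)
  case (Cons a w)
  then show ?case using step_range[of a n p] by (auto simp: seq_def split: option.splits)
qed simp

lemma step_inj:
  "a \<in> alphabet n XM \<Longrightarrow> step a p = Some (m, r) \<Longrightarrow> step a q = Some (m', r) \<Longrightarrow> p = q"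
  by (cases a) (auto simp: alphabet_def split: if_splits)

lemma path_inj:
  assumes "w \<in> lists (alphabet n XM)" "path w p = Some (m, r)" "path w q = Some (m', r)"
  shows "p = q"
  using assms
proof (induction w arbitrary: p q m m')
  case (Cons a w)
  obtain m1 p' m2 where p': "step a p = Some (m1, p')" "path w p' = Some (m2, r)"
    using Cons.prems(1) by (auto simp: seq_def split: option.splits)
  obtain m1' q' m2' where q': "step a q = Some (m1', q')" "path w q' = Some (m2', r)"
    using Cons.prems(2) by (auto simp: seq_def split: option.splits)
  have "p' = q'" using Cons.IH[OF p'(2) q'(2)] .
  then show ?case using step_inj[of a n p m1 p' q m1'] p' q' Cons.hyps(1) by simp
qed simp

lemma path_outside:
  assumes "w \<in> lists (alphabet n XM)" "p \<notin> {1..n}"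
  shows "path w p = Some (\<one>, p)"
  using assms(1)
proof (induction w)
  case (Cons a w)
  then have "step a p = Some (\<one>, p)" using assms(2) by (cases a) (auto simp: alphabet_def)
  then show ?case using Cons by (simp add: seq_def)
qed simp

lemma extension_encode:
  assumes "w \<in> lists (alphabet n XM)" "w \<noteq> []"
  shows "semigroup_extension (sing_wreath M n) (letter_image M \<phi>M n) w = encode n (path w)"
  using assms
proof (induction w rule: induct_list012)
  case (2 a)
  then show ?case using letter_image_encode[of a n] path_letter[of a n] by simp
next
  case (3 a b w)
  then have "semigroup_extension (sing_wreath M n) (letter_image M \<phi>M n) (a # b # w) =
      encode n (step a) \<otimes>\<^bsub>sing_wreath M n\<^esub> encode n (path (b # w))"
    using letter_image_encode[of a n] by simp
  also have "\<dots> = encode n (seq (step a) (path (b # w)))"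
  proof (rule encode_mult)
    fix p m q assume "p \<in> {1..n}" "step a p = Some (m, q)"
    then show "q \<in> {1..n}" using step_range[of a n p m q] "3.prems" by simp
  qed
  finally show ?case by (simp only: path.simps)
qed simp

lemma encode_path_inject:
  assumes "u \<in> lists (alphabet n XM)" "v \<in> lists (alphabet n XM)"
    "encode n (path u) = encode n (path v)"
  shows "path u = path v"
proof
  fix p
  show "path u p = path v p"
  proof (cases "p \<in> {1..n}")
    case True
    have "fst (encode n (path u)) p = fst (encode n (path v)) p"
      "snd (encode n (path u)) p = snd (encode n (path v)) p"
      by (simp_all only: assms(3))
    then have "map_option fst (path u p) = map_option fst (path v p)"
      "map_option snd (path u p) = map_option snd (path v p)"
      using True by (simp_all add: encode_def)
    then show ?thesis by (cases "path u p"; cases "path v p") (auto simp: prod_eq_iff)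
  next
    case False
    then show ?thesis using path_outside assms(1,2) by simp
  qed
qed

lemma encode_path_carrier:
  assumes "w \<in> lists (alphabet n XM)" "w \<noteq> []"
  shows "encode n (path w) \<in> carrier (sing_wreath M n)"
proof -
  obtain a \<alpha> where enc: "encode n (path w) = (a, \<alpha>)" by fastforce
  then have a: "a = (\<lambda>p\<in>{1..n}. map_option fst (path w p))"
    and \<alpha>: "\<alpha> = (\<lambda>p. if p \<in> {1..n} then map_option snd (path w p) else None)"
    by (simp_all add: encode_def)
  have "map_option fst (path w p) \<in> carrier (adjoin_zero M)" for p
    using path_closed[OF assms(1), of p] by (cases "path w p") (auto simp: adjoin_zero_def)
  then have "a \<in> carrier (zero_power M n)"
    by (simp add: a zero_power_def product_group_def)
  moreover have "supp n a = dom \<alpha>"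
    by (auto simp: supp_def a \<alpha> split: if_splits)
  moreover have "\<alpha> \<in> sym_inv_monoid n"
  proof -
    have \<alpha>_Some: "\<exists>m. p \<in> {1..n} \<and> path w p = Some (m, r)" if "\<alpha> p = Some r" for p r
      using that by (auto simp: \<alpha> split: if_splits)
    have "dom \<alpha> \<subseteq> {1..n}" using \<alpha>_Some by blast
    moreover have "ran \<alpha> \<subseteq> {1..n}"
      using \<alpha>_Some path_range[OF assms(1)] unfolding ran_def by blast
    moreover have "inj_on \<alpha> (dom \<alpha>)"
    proof (rule inj_onI)
      fix p q assume "p \<in> dom \<alpha>" "\<alpha> p = \<alpha> q"
      then obtain r where "\<alpha> p = Some r" "\<alpha> q = Some r" by (metis domD)
      then show "p = q" using \<alpha>_Some path_inj[OF assms(1)] by blast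
    qed
    ultimately show ?thesis by (simp add: sym_inv_monoid_def)
  qed
  moreover have "dom \<alpha> \<noteq> {1..n}"
  proof -
    obtain b v where w: "w = b # v" "b \<in> alphabet n XM" using assms by (cases w) auto
    have "hole_in b \<in> {1..n} \<and> step b (hole_in b) = None"
      using w(2) by (cases b) (auto simp: alphabet_def)
    then have "hole_in b \<in> {1..n}" "\<alpha> (hole_in b) = None" using w by (simp_all add: \<alpha> seq_None)
    then show ?thesis by (metis domIff)
  qed
  ultimately show ?thesis using enc by (simp add: sing_wreath_def Sing_def sym_grp_def)
qed

end

context faithful_relations
begin

lemma path_hop:
  assumes "p \<noteq> h"
  shows "path (hop h k) p = Some (\<one>, transpose h k p)"
  using assms by (auto simp: hop_def seq_def transpose_def)

text \<open>With holes \<open>h\<close> outside the domain and \<open>k\<close> outside the image of \<open>\<alpha>\<close>, a word for \<open>(a, \<alpha>)\<close> is a normal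
  form at \<open>h\<close>, followed by the move of the hole from \<open>h\<close> to \<open>k\<close>. Its permutation is any extension of
  \<open>\<alpha>\<close>, corrected for that move.\<close>

lemma encode_path_surj:
  assumes "x \<in> carrier (sing_wreath M n)"
  shows "\<exists>w \<in> words. w \<noteq> [] \<and> x = encode n (path w)"
proof -
  obtain a \<alpha> where x: "x = (a, \<alpha>)" by fastforce
  have a: "a \<in> carrier (zero_power M n)" and supp: "supp n a = dom \<alpha>" and \<alpha>: "\<alpha> \<in> Sing n"
    using assms x by (auto simp: sing_wreath_def)
  have dom: "dom \<alpha> \<subseteq> N" and ran: "ran \<alpha> \<subseteq> N" and inj: "inj_on \<alpha> (dom \<alpha>)"
    using \<alpha> by (auto simp: Sing_def sym_inv_monoid_def N_def)
  have fin: "finite N" by (simp add: N_def)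
  have card: "card (ran \<alpha>) = card (dom \<alpha>)"
  proof -
    have "ran \<alpha> = (the \<circ> \<alpha>) ` dom \<alpha>" by (force simp: ran_def)
    moreover have "inj_on (the \<circ> \<alpha>) (dom \<alpha>)"
      using inj unfolding inj_on_def comp_def by (metis domIff option.expand)
    ultimately show ?thesis by (metis card_image)
  qed
  have "dom \<alpha> \<noteq> N"
  proof
    assume "dom \<alpha> = N"
    then have "ran \<alpha> = N" using card ran fin by (simp add: card_subset_eq)
    then show False using \<open>dom \<alpha> = N\<close> \<alpha> by (simp add: Sing_def sym_grp_def N_def)
  qed
  then obtain h where h: "h \<in> N" "h \<notin> dom \<alpha>" using dom by blast
  have "ran \<alpha> \<noteq> N"
    using card \<open>dom \<alpha> \<noteq> N\<close> dom fin card_subset_eq by metis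
  then obtain k where k: "k \<in> N" "k \<notin> ran \<alpha>" using ran by blast
  \<comment> \<open>As no point is sent to \<open>k\<close>, the transposition clears \<open>h\<close>, so \<open>\<beta>\<close> avoids the hole.\<close>
  define \<beta> where "\<beta> p = transpose h k (the (\<alpha> p))" for p
  have "inj_on \<beta> (dom \<alpha>)"
    using inj by (auto simp: \<beta>_def inj_on_def dom_def) (metis transpose_involutory)
  moreover have "\<beta> ` dom \<alpha> \<subseteq> P h"
  proof
    fix q assume "q \<in> \<beta> ` dom \<alpha>"
    then obtain p r where "\<alpha> p = Some r" "q = transpose h k r" by (auto simp: \<beta>_def)
    moreover from this have "r \<in> N" "r \<noteq> k" using ran k(2) by (auto simp: ran_def)
    ultimately show "q \<in> P h" using h k by (auto simp: transpose_def)
  qed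
  moreover have "dom \<alpha> \<subseteq> P h" using dom h by auto
  ultimately obtain \<pi> where \<pi>: "\<pi> permutes P h" "\<And>p. p \<in> dom \<alpha> \<Longrightarrow> \<pi> p = \<beta> p"
    using injection_extends_to_permutation[of "P h" "dom \<alpha>" \<beta>] fin by auto
  obtain ts where ts: "ts \<in> lists (pairs (P h))" "perm ts = \<pi>"
    using permutation_is_perm[OF \<pi>(1)] fin by auto
  have a_PiE: "a \<in> {1..n} \<rightarrow>\<^sub>E insert None (Some ` carrier M)"
    using a by (simp add: zero_power_def product_group_def adjoin_zero_def)
  have "a p \<in> insert None (Some ` carrier M)" if "p \<in> P h" for p
    using PiE_mem[OF a_PiE, of p] that by (simp add: N_def)
  then have "a p = Some m \<Longrightarrow> m \<in> carrier M" if "p \<in> P h" for p m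
    using that by fastforce
  then obtain D where D: "D \<in> lists (entries XM (P h))" and
    diag: "\<And>p. p \<in> P h \<Longrightarrow> (if (None, p) \<in> set D then None else Some (\<phi>M (letters_at p D))) = a p"
    using diag_exists[of "P h" a] fin by blast
  define v where "v = E h # diag_word h D @ swap_word h ts"
  have words: "v \<in> words" "hop h k \<in> words"
    using diag_word_letters[OF h(1) D] swap_word_letters[OF h(1) ts(1)] h(1) k(1)
    by (auto simp: v_def hop_def)
  have path: "path (v @ hop h k) p = (case a p of None \<Rightarrow> None | Some m \<Rightarrow> Some (m, the (\<alpha> p)))"
    if p: "p \<in> N" for p
  proof (cases "p = h")
    case True
    then have "a p = None" using supp h by (auto simp: supp_def N_def)
    then show ?thesis using True words by (simp add: path_append seq_def v_def)
  next
    case False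
    have v: "path v p = (if (None, p) \<in> set D then None else Some (\<phi>M (letters_at p D), \<pi> p))"
      using path_normal[OF h(1) D ts(1), of p] False ts(2) by (simp add: v_def)
    show ?thesis
    proof (cases "a p")
      case None
      then have "path v p = None" using diag[of p] v p False by (auto split: if_splits)
      then show ?thesis using None words by (simp add: path_append seq_None)
    next
      case (Some m)
      then have m: "path v p = Some (m, \<pi> p)" "m \<in> carrier M"
        using diag[of p] v p False path_closed[OF words(1), of p] by (auto split: if_splits)
      have "p \<in> dom \<alpha>" using Some p supp by (auto simp: supp_def N_def)
      then have "\<pi> p = transpose h k (the (\<alpha> p))" "\<pi> p \<noteq> h"
        using \<pi>(2)[of p] \<open>\<beta> ` dom \<alpha> \<subseteq> P h\<close> by (auto simp: \<beta>_def)
      then show ?thesis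
        using Some m words path_hop[of "\<pi> p" h k]
        by (simp add: path_append[OF words] seq_Some[of "path v" p m "\<pi> p"])
    qed
  qed
  have "encode n (path (v @ hop h k)) = x"
  proof -
    have "(\<lambda>p\<in>{1..n}. map_option fst (path (v @ hop h k) p)) = a"
    proof
      fix p
      show "(\<lambda>p\<in>{1..n}. map_option fst (path (v @ hop h k) p)) p = a p"
        using a path[of p]
        by (cases "a p") (auto simp: zero_power_def product_group_def N_def PiE_iff extensional_def)
    qed
    moreover have "(\<lambda>p. if p \<in> {1..n} then map_option snd (path (v @ hop h k) p) else None) = \<alpha>"
    proof
      fix p
      show "(if p \<in> {1..n} then map_option snd (path (v @ hop h k) p) else None) = \<alpha> p"
      proof (cases "p \<in> dom \<alpha>")
        case True
        then have "p \<in> {1..n}" "a p \<noteq> None" using supp by (auto simp: supp_def)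
        then show ?thesis using path[of p] True by (auto simp: N_def)
      next
        case False
        then have "p \<in> {1..n} \<Longrightarrow> a p = None" using supp by (auto simp: supp_def)
        then show ?thesis using path[of p] False by (auto simp: N_def)
      qed
    qed
    ultimately show ?thesis by (simp add: encode_def x)
  qed
  then show ?thesis using words by (intro bexI[of _ "v @ hop h k"]) (auto simp: v_def)
qed

end

section \<open>The presentation\<close>

theorem theorem5p37:
  fixes M :: "('b, 'm) monoid_scheme"
    and XM :: "'x set" and RM :: "('x list \<times> 'x list) set" and \<phi>M :: "'x list \<Rightarrow> 'b"
    and n :: nat
  assumes "Group.monoid M"
    and "has_monoid_presentation M XM RM \<phi>M"
    and "n \<ge> 2"
  shows "has_semigroup_presentation (sing_wreath M n) (alphabet n XM) (relations n XM RM)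
           (semigroup_extension (sing_wreath M n) (letter_image M \<phi>M n))"
proof -
  interpret presented_monoid M XM RM \<phi>M
    using assms(1,2) by (simp add: presented_monoid_def presented_monoid_axioms_def)
  interpret W: faithful_relations M XM RM \<phi>M n "universal.left_mult n"
    by (rule universal_faithful)
  let ?W = "sing_wreath M n" and ?X = "alphabet n XM"
  let ?\<phi> = "semigroup_extension ?W (letter_image M \<phi>M n)"
  have carrier: "carrier (free_semigroup ?X) = lists ?X - {[]}"
    and mult: "u \<otimes>\<^bsub>free_semigroup ?X\<^esub> v = u @ v" for u v
    by (simp_all add: free_semigroup_def)
  have "?\<phi> \<in> hom (free_semigroup ?X) ?W"
  proof (rule homI)
    fix u v assume "u \<in> carrier (free_semigroup ?X)" "v \<in> carrier (free_semigroup ?X)"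
    then have uv: "u \<in> lists ?X" "u \<noteq> []" "v \<in> lists ?X" "v \<noteq> []" by (auto simp: carrier)
    show "?\<phi> u \<in> carrier ?W"
      using extension_encode encode_path_carrier uv by simp
    have "encode n (path u) \<otimes>\<^bsub>?W\<^esub> encode n (path v) = encode n (path (u @ v))"
      unfolding path_append[OF uv(1,3)] by (rule encode_mult[OF path_range[OF uv(1)]])
    then show "?\<phi> (u \<otimes>\<^bsub>free_semigroup ?X\<^esub> v) = ?\<phi> u \<otimes>\<^bsub>?W\<^esub> ?\<phi> v"
      using extension_encode[of _ n] uv by (simp add: mult)
  qed
  moreover have "?\<phi> ` carrier (free_semigroup ?X) = carrier ?W"
  proof
    show "?\<phi> ` carrier (free_semigroup ?X) \<subseteq> carrier ?W"
    proof
      fix x assume "x \<in> ?\<phi> ` carrier (free_semigroup ?X)"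
      then obtain w where "w \<in> lists ?X" "w \<noteq> []" "x = ?\<phi> w" by (auto simp: carrier)
      then show "x \<in> carrier ?W" using extension_encode[of w n] encode_path_carrier[of w n] by simp
    qed
    show "carrier ?W \<subseteq> ?\<phi> ` carrier (free_semigroup ?X)"
      using W.encode_path_surj extension_encode[of _ n] by (fastforce simp: carrier)
  qed
  moreover have "kernel_on (carrier (free_semigroup ?X)) ?\<phi> =
    generated_congruence (free_semigroup ?X) (relations n XM RM)"
  proof (rule subset_antisym; rule subsetI)
    fix p assume "p \<in> kernel_on (carrier (free_semigroup ?X)) ?\<phi>"
    then obtain u v where p: "p = (u, v)" and
      uv: "u \<in> lists ?X" "u \<noteq> []" "v \<in> lists ?X" "v \<noteq> []" and "?\<phi> u = ?\<phi> v"
      by (auto simp: kernel_on_def carrier)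
    then have "path u = path v"
      using encode_path_inject[of u n v] extension_encode[of _ n] by simp
    then have "W.eval u = W.eval v"
      using W.path_determines_eval uv by blast
    then have "u = v \<or> (u, v) \<in> generated_congruence (free_semigroup ?X) (relations n XM RM)"
      using universal.act_word_faithful[of u n v] uv by (simp add: W.eval_def)
    then show "p \<in> generated_congruence (free_semigroup ?X) (relations n XM RM)"
      using p uv generated_congruence.refl[of u "free_semigroup ?X"] by (auto simp: carrier)
  next
    fix p assume p: "p \<in> generated_congruence (free_semigroup ?X) (relations n XM RM)"
    obtain u v where uv: "p = (u, v)" by fastforce
    then have "path u = path v" "u \<in> lists ?X" "u \<noteq> []" "v \<in> lists ?X" "v \<noteq> []"
      using p path_congruence universal.rel_carrier[of u v n] by auto
    then show "p \<in> kernel_on (carrier (free_semigroup ?X)) ?\<phi>"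
      using extension_encode[of _ n] uv by (simp add: kernel_on_def carrier)
  qed
  ultimately show ?thesis
    using relations_nonempty unfolding has_semigroup_presentation_def by blast
qed

end
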